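(* Let $G=(V,E)$ be a connected graph and let $C=(V_C,E_C)$ be a cycle in $G$. Let $5\le k\le|V_C|$ with $k$ odd, $d=\frac{k-1}{2}$, and let $v:\mathbb{Z}_k\to V_C$ be injective and true to $C$. Then the half-chorded odd cycle inequality $\sum_{i\in\mathbb{Z}_k}(x_{v_iv_{i+d}}-x_{v_iv_{i+1}})\le k-3$ is facet-defining for $\mathrm{LMC}(G)$.
   Context: Indices of $v$ are taken modulo $k$. Let $m=|V_C|$ and identify $V_C$ with $\mathbb{Z}_m$ so that $E_C=\{\{u,u+1\}:u\in\mathbb{Z}_m\}$. For $a,b\in\mathbb{Z}_m$, $[a,b]=\{a,a+1,\dots,b\}$ (forward along the cycle), $[a,b[\,=[a,b]\setminus\{b\}$, $]a,b]=[a,b]\setminus\{a\}$. The sequence $v$ is true to $C$ if either $v_i\in[v_0,v_{i+1}[$ for all $i=0,\dots,k-2$, or $v_i\in\,]v_{i+1},v_0]$ for all $i=0,\dots,k-2$. A decomposition of $G$ is a partition of $V$ whose blocks induce connected subgraphs of $G$; its lifted multicut is the set of pairs $ab\in\binom{V}{2}$ with $a,b$ in distinct blocks. $\mathrm{LMC}(G)\subseteq\mathbb{R}^{\binom{V}{2}}$ is the convex hull of the characteristic vectors of these lifted multicuts over all decompositions of $G$. *)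

theory Defs
  imports "HOL-Analysis.Analysis" "HOL-Library.Disjoint_Sets"
begin

definition pairs :: "'v set \<Rightarrow> 'v set set" where
  "pairs V = {e. e \<subseteq> V \<and> card e = 2}"

definition simple_graph :: "'v set \<Rightarrow> 'v set set \<Rightarrow> bool" where
  "simple_graph V E \<longleftrightarrow> finite V \<and> E \<subseteq> pairs V"

definition connected_graph :: "'v set \<Rightarrow> 'v set set \<Rightarrow> bool" where
  "connected_graph V E \<longleftrightarrow>
     simple_graph V E \<and> V \<noteq> {} \<and> (\<forall>a\<in>V. \<forall>b\<in>V. (a, b) \<in> {(p, q). {p, q} \<in> E}\<^sup>*)"

definition induced_edges :: "'v set set \<Rightarrow> 'v set \<Rightarrow> 'v set set" where
  "induced_edges E B = {e \<in> E. e \<subseteq> B}"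

definition decomposition :: "'v set \<Rightarrow> 'v set set \<Rightarrow> 'v set set \<Rightarrow> bool" where
  "decomposition V E P \<longleftrightarrow>
     partition_on V P \<and> (\<forall>B\<in>P. connected_graph B (induced_edges E B))"

definition lifted_multicut :: "'v set set \<Rightarrow> 'v set set" where
  "lifted_multicut P = {{a, b} | a b. \<exists>A\<in>P. \<exists>B\<in>P. A \<noteq> B \<and> a \<in> A \<and> b \<in> B}"

definition char_vec :: "'v set set \<Rightarrow> real ^ ('v::finite set)" where
  "char_vec M = (\<chi> e. if e \<in> M then 1 else 0)"

text \<open>
  The space of real vectors indexed by the two-element subsets of \<open>V\<close> is represented as the
  coordinate subspace of \<open>real ^ ('v set)\<close> on which all other coordinates vanish; lifted multicuts
  only contain two-element subsets of \<open>V\<close>, so \<open>LMC\<close> lies in this subspace. Faces and affine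
  dimensions do not depend on the ambient space.
\<close>

definition LMC :: "'v::finite set \<Rightarrow> 'v set set \<Rightarrow> (real ^ ('v set)) set" where
  "LMC V E = convex hull {char_vec (lifted_multicut P) | P. decomposition V E P}"

definition facet_defining :: "'a::euclidean_space set \<Rightarrow> ('a \<Rightarrow> real) \<Rightarrow> real \<Rightarrow> bool" where
  "facet_defining P f b \<longleftrightarrow>
     linear f \<and> (\<forall>x\<in>P. f x \<le> b) \<and> {x \<in> P. f x = b} facet_of P"

text \<open>
  The integers modulo \<open>m\<close> are represented by \<open>{..<m}\<close>. The map \<open>c\<close> is the identification of
  the integers modulo \<open>card V\<^sub>C\<close> with the vertex set of the cycle.
\<close>

definition cycle_labelling :: "(nat \<Rightarrow> 'v) \<Rightarrow> 'v set \<Rightarrow> 'v set set \<Rightarrow> bool" where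
  "cycle_labelling c V\<^sub>C E\<^sub>C \<longleftrightarrow>
     3 \<le> card V\<^sub>C \<and> bij_betw c {..<card V\<^sub>C} V\<^sub>C \<and>
     E\<^sub>C = {{c u, c ((u + 1) mod card V\<^sub>C)} | u. u < card V\<^sub>C}"

text \<open>
  For \<open>a, b < m\<close>, the number of forward steps from \<open>a\<close> to \<open>b\<close> is \<open>(b + m - a) mod m\<close>.
\<close>

definition cyc_cc :: "nat \<Rightarrow> nat \<Rightarrow> nat \<Rightarrow> nat set" where
  "cyc_cc m a b = {(a + j) mod m | j. j \<le> (b + m - a) mod m}"

definition cyc_co :: "nat \<Rightarrow> nat \<Rightarrow> nat \<Rightarrow> nat set" where
  "cyc_co m a b = cyc_cc m a b - {b}"

definition cyc_oc :: "nat \<Rightarrow> nat \<Rightarrow> nat \<Rightarrow> nat set" where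
  "cyc_oc m a b = cyc_cc m a b - {a}"

definition true_to_cycle :: "(nat \<Rightarrow> 'v) \<Rightarrow> 'v set \<Rightarrow> nat \<Rightarrow> (nat \<Rightarrow> 'v) \<Rightarrow> bool" where
  "true_to_cycle c V\<^sub>C k v \<longleftrightarrow>
     (let m = card V\<^sub>C; p = (\<lambda>i. the_inv_into {..<m} c (v i)) in
       (\<forall>i<k - 1. p i \<in> cyc_co m (p 0) (p (i + 1))) \<or>
       (\<forall>i<k - 1. p i \<in> cyc_oc m (p (i + 1)) (p 0)))"

end

theory Submission
  imports Defs "HOL-Library.Sublist"
begin

text \<open>
  Call the \<open>v\<^sub>i\<close> terminals. A decomposition is tight, i.e. attains equality, if it splits the terminals
  into two cyclic intervals of sizes \<open>d\<close> and \<open>d + 1\<close>, or into three cyclic intervals of size at most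
  \<open>d\<close> each; all other vertices are free. Let \<open>\<alpha>\<close> be a linear functional that is constant on the tight
  decompositions. If moving a vertex \<open>x\<close> from a block \<open>M\<close> to a block \<open>N\<close> preserves tightness, then the sum
  of \<open>\<alpha>\<^bsub>xz\<^esub>\<close> over \<open>z \<in> M\<close> equals the sum over \<open>z \<in> N\<close>. A vertex \<open>x\<close> that is not a terminal may leave
  any block that meets the terminals in an interval of size at most \<open>d + 1\<close>; letting the block grow
  along a walk starting at \<open>x\<close> gives \<open>\<alpha>\<^bsub>xz\<^esub> = 0\<close> for one \<open>z\<close> after the other. Moving \<open>v\<^sub>i\<close> between
  two adjacent intervals shows that the sum of \<open>\<alpha>\<^bsub>i,i+l\<^esub>\<close> over \<open>1 \<le> l \<le> p\<close> equals the sum of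
  \<open>\<alpha>\<^bsub>i,i-l\<^esub>\<close> over \<open>1 \<le> l \<le> r\<close>, both for \<open>p + r = d\<close> and for \<open>p + r = d + 1\<close> with \<open>p, r \<ge> 2\<close>.
  Comparing these equations gives \<open>\<alpha>\<^bsub>i,i+n\<^esub> = 0\<close> for \<open>2 \<le> n \<le> d - 1\<close>, then \<open>\<alpha>\<^bsub>i,i+1\<^esub> = \<alpha>\<^bsub>i-1,i\<^esub>\<close>
  and \<open>\<alpha>\<^bsub>i,i+1\<^esub> = - \<alpha>\<^bsub>i,i+d\<^esub>\<close>. Hence \<open>\<alpha>\<close> is a multiple of the functional of the inequality, which
  bounds the codimension of the tight face by one.
\<close>

subsection \<open>Vertex pairs, connected sets and decompositions\<close>

abbreviation walk :: "'v set set \<Rightarrow> 'v list \<Rightarrow> bool" where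
  "walk E \<equiv> successively (\<lambda>a b. {a, b} \<in> E)"

lemma doubleton_in_pairs_iff: "{a, b} \<in> pairs V \<longleftrightarrow> a \<in> V \<and> b \<in> V \<and> a \<noteq> b"
  by (auto simp: pairs_def card_insert_if)

lemma pairs_cases:
  assumes "e \<in> pairs V"
  obtains a b where "e = {a, b}" "a \<in> V" "b \<in> V" "a \<noteq> b"
  using assms by (auto simp: pairs_def card_2_iff)

lemma pairs_insert: "x \<notin> V \<Longrightarrow> pairs (insert x V) = pairs V \<union> (\<lambda>z. {x, z}) ` V"
proof (intro set_eqI iffI)
  fix e assume "x \<notin> V" "e \<in> pairs (insert x V)"
  from this(2) obtain a b where "e = {a, b}" "a \<in> insert x V" "b \<in> insert x V" "a \<noteq> b"
    by (rule pairs_cases)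
  then show "e \<in> pairs V \<union> (\<lambda>z. {x, z}) ` V"
    by (cases "a = x"; cases "b = x") (auto simp: doubleton_in_pairs_iff)
qed (auto simp: pairs_def card_insert_if)

lemma sum_pairs_insert:
  fixes F :: "'v set \<Rightarrow> 'a::comm_monoid_add"
  assumes "finite V" "x \<notin> V"
  shows "(\<Sum>e\<in>pairs (insert x V). F e) = (\<Sum>e\<in>pairs V. F e) + (\<Sum>z\<in>V. F {x, z})"
proof -
  have "finite (pairs V)" using assms(1) by (simp add: pairs_def)
  moreover have "pairs V \<inter> (\<lambda>z. {x, z}) ` V = {}" using assms(2) by (auto simp: pairs_def)
  moreover have "inj_on (\<lambda>z. {x, z}) V" by (auto simp: inj_on_def doubleton_eq_iff)
  ultimately show ?thesis
    unfolding pairs_insert[OF assms(2)] using assms(1)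
    by (subst sum.union_disjoint) (simp_all add: sum.reindex)
qed

lemma sum_uncut_incident_eq:
  fixes \<alpha> :: "'v set \<Rightarrow> 'a::ab_group_add"
  assumes "finite V" "x \<in> V" "S \<subseteq> pairs V" "T \<subseteq> pairs V"
    and agree: "\<And>e. e \<in> pairs (V - {x}) \<Longrightarrow> e \<in> S \<longleftrightarrow> e \<in> T"
    and "sum \<alpha> S = sum \<alpha> T"
  shows "(\<Sum>z | z \<in> V - {x} \<and> {x, z} \<notin> S. \<alpha> {x, z}) = (\<Sum>z | z \<in> V - {x} \<and> {x, z} \<notin> T. \<alpha> {x, z})"
proof -
  have V: "V = insert x (V - {x})" using assms(2) by blast
  have split: "sum \<alpha> U = (\<Sum>e\<in>pairs (V - {x}). if e \<in> U then \<alpha> e else 0) +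
      (\<Sum>z\<in>V - {x}. \<alpha> {x, z}) - (\<Sum>z | z \<in> V - {x} \<and> {x, z} \<notin> U. \<alpha> {x, z})"
    if "U \<subseteq> pairs V" for U
  proof -
    have "finite (pairs V)" using assms(1) by (simp add: pairs_def)
    then have "sum \<alpha> U = (\<Sum>e\<in>pairs V. if e \<in> U then \<alpha> e else 0)"
      using that by (simp add: sum.inter_restrict[symmetric] Int_absorb1)
    also have "\<dots> = (\<Sum>e\<in>pairs (V - {x}). if e \<in> U then \<alpha> e else 0) +
        (\<Sum>z\<in>V - {x}. if {x, z} \<in> U then \<alpha> {x, z} else 0)"
      using assms(1) by (subst V, subst sum_pairs_insert) auto
    also have "(\<Sum>z\<in>V - {x}. if {x, z} \<in> U then \<alpha> {x, z} else 0) =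
        (\<Sum>z\<in>V - {x}. \<alpha> {x, z}) - (\<Sum>z\<in>V - {x}. if {x, z} \<notin> U then \<alpha> {x, z} else 0)"
      by (subst sum_subtractf[symmetric]) (intro sum.cong; simp)
    also have "(\<Sum>z\<in>V - {x}. if {x, z} \<notin> U then \<alpha> {x, z} else 0) =
        (\<Sum>z | z \<in> V - {x} \<and> {x, z} \<notin> U. \<alpha> {x, z})"
      using assms(1) by (simp only: sum.inter_filter finite_Diff)
    finally show ?thesis by simp
  qed
  have "(\<Sum>e\<in>pairs (V - {x}). if e \<in> S then \<alpha> e else 0) = (\<Sum>e\<in>pairs (V - {x}). if e \<in> T then \<alpha> e else 0)"
    using agree by (intro sum.cong) auto
  then show ?thesis using split[OF assms(3)] split[OF assms(4)] assms(6) by simp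
qed

definition connected_subset :: "'v set \<Rightarrow> 'v set set \<Rightarrow> 'v set \<Rightarrow> bool" where
  "connected_subset V E S \<longleftrightarrow> S \<subseteq> V \<and> (S = {} \<or> connected_graph S (induced_edges E S))"

lemma connected_subset_empty [simp]: "connected_subset V E {}"
  by (simp add: connected_subset_def)

lemma connected_subset_singleton:
  assumes "simple_graph V E" "x \<in> V"
  shows "connected_subset V E {x}"
  using assms
  by (auto simp: connected_subset_def connected_graph_def simple_graph_def induced_edges_def pairs_def)

lemma connected_subset_insert:
  assumes "simple_graph V E" "connected_subset V E S" "u \<in> S" "{u, z} \<in> E"
  shows "connected_subset V E (insert z S)"
proof -
  define R where "R S = {(p, q). {p, q} \<in> induced_edges E S}" for S
  have E: "E \<subseteq> pairs V" "finite V" and S: "S \<subseteq> V" "connected_graph S (induced_edges E S)"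
    using assms by (auto simp: simple_graph_def connected_subset_def)
  have "R S \<subseteq> R (insert z S)" by (auto simp: R_def induced_edges_def)
  then have mono: "(R S)\<^sup>* \<subseteq> (R (insert z S))\<^sup>*" by (rule rtrancl_mono)
  have edge: "(u, z) \<in> R (insert z S)" "(z, u) \<in> R (insert z S)"
    using assms(3,4) by (auto simp: R_def induced_edges_def insert_commute)
  have "(a, u) \<in> (R (insert z S))\<^sup>* \<and> (u, a) \<in> (R (insert z S))\<^sup>*" if "a \<in> insert z S" for a
  proof (cases "a = z")
    case True
    then show ?thesis using edge by blast
  next
    case False
    then have "(a, u) \<in> (R S)\<^sup>*" "(u, a) \<in> (R S)\<^sup>*"
      using that S(2) assms(3) by (auto simp: connected_graph_def R_def)
    then show ?thesis using mono by blast
  qed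
  then have "\<forall>a\<in>insert z S. \<forall>b\<in>insert z S. (a, b) \<in> (R (insert z S))\<^sup>*"
    by (meson rtrancl_trans)
  moreover have "z \<in> V" using assms(4) E(1) by (auto simp: pairs_def)
  moreover have "simple_graph (insert z S) (induced_edges E (insert z S))"
    using E S(1) by (auto simp: simple_graph_def induced_edges_def pairs_def intro: finite_subset)
  ultimately show ?thesis using S(1) by (auto simp: connected_subset_def connected_graph_def R_def)
qed

lemma walk_subset:
  assumes "simple_graph V E" "walk E (x # xs)" "x \<in> V"
  shows "set xs \<subseteq> V"
  using assms(2,3)
proof (induction xs arbitrary: x)
  case (Cons y xs)
  then have "{x, y} \<in> pairs V" using assms(1) by (auto simp: simple_graph_def)
  then show ?case using Cons by (auto simp: doubleton_in_pairs_iff)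
qed simp

lemma connected_subset_walk:
  assumes "simple_graph V E" "walk E xs" "set xs \<subseteq> V"
  shows "connected_subset V E (set xs)"
  using assms(2,3)
proof (induction xs)
  case (Cons x xs)
  show ?case
  proof (cases "xs = []")
    case True
    then show ?thesis using Cons.prems connected_subset_singleton[OF assms(1)] by simp
  next
    case False
    then have "{hd xs, x} \<in> E" "walk E xs" "hd xs \<in> set xs"
      using Cons.prems by (auto simp: successively_Cons insert_commute)
    then show ?thesis using Cons connected_subset_insert[OF assms(1)] by auto
  qed
qed simp

definition block_family :: "'v set \<Rightarrow> 'v set set \<Rightarrow> 'v set set \<Rightarrow> bool" where
  "block_family V E \<B> \<longleftrightarrow> disjoint \<B> \<and> (\<forall>B\<in>\<B>. connected_subset V E B)"

definition with_singletons :: "'v set \<Rightarrow> 'v set set \<Rightarrow> 'v set set" where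
  "with_singletons V \<B> = \<B> - {{}} \<union> {{z} | z. z \<in> V - \<Union>\<B>}"

lemma block_family_empty [simp]: "block_family V E {}"
  by (simp add: block_family_def)

lemma block_family_insertI:
  assumes "connected_subset V E B" "block_family V E \<B>" "B \<inter> \<Union>\<B> = {}"
  shows "block_family V E (insert B \<B>)"
  using assms by (auto simp: block_family_def disjoint_def)

lemma block_family_Union_subset: "block_family V E \<B> \<Longrightarrow> \<Union>\<B> \<subseteq> V"
  by (auto simp: block_family_def connected_subset_def)

lemma block_family_unique: "block_family V E \<B> \<Longrightarrow> A \<in> \<B> \<Longrightarrow> B \<in> \<B> \<Longrightarrow> z \<in> A \<Longrightarrow> z \<in> B \<Longrightarrow> A = B"
  by (auto simp: block_family_def disjoint_def)

lemma decomposition_with_singletons: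
  assumes "simple_graph V E" "block_family V E \<B>"
  shows "decomposition V E (with_singletons V \<B>)"
  unfolding decomposition_def
proof (intro conjI ballI)
  show "partition_on V (with_singletons V \<B>)"
  proof (rule partition_onI)
    have "\<Union>(with_singletons V \<B>) = \<Union>\<B> \<union> (V - \<Union>\<B>)"
      by (auto simp: with_singletons_def)
    then show "\<Union>(with_singletons V \<B>) = V"
      using block_family_Union_subset[OF assms(2)] by (simp add: Un_absorb1)
    show "disjnt A B" if "A \<in> with_singletons V \<B>" "B \<in> with_singletons V \<B>" "A \<noteq> B" for A B
      using that assms(2) by (auto simp: with_singletons_def disjnt_def block_family_def disjoint_def)
  qed (auto simp: with_singletons_def)
  fix B assume "B \<in> with_singletons V \<B>"
  then have "connected_subset V E B" "B \<noteq> {}"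
    using assms(2) connected_subset_singleton[OF assms(1)]
    by (auto simp: with_singletons_def block_family_def)
  then show "connected_graph B (induced_edges E B)" by (simp add: connected_subset_def)
qed

definition containing_blocks :: "'v set set \<Rightarrow> 'v \<Rightarrow> 'v set set" where
  "containing_blocks P z = {B \<in> P. z \<in> B}"

lemma containing_blocks_partition:
  assumes "partition_on V P" "B \<in> P" "z \<in> B"
  shows "containing_blocks P z = {B}"
  using partition_onD2[OF assms(1)] assms(2,3) by (auto simp: containing_blocks_def disjoint_def)

lemma containing_blocks_with_singletons_eq_iff:
  assumes "block_family V E \<B>" "a \<in> V" "b \<in> V"
  shows "containing_blocks (with_singletons V \<B>) a = containing_blocks (with_singletons V \<B>) b \<longleftrightarrow>
    a = b \<or> (\<exists>B\<in>\<B>. a \<in> B \<and> b \<in> B)"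
proof -
  have block: "containing_blocks (with_singletons V \<B>) z = {B}" if "B \<in> \<B>" "z \<in> B" for B z
    using that block_family_unique[OF assms(1)] by (auto simp: containing_blocks_def with_singletons_def)
  have single: "containing_blocks (with_singletons V \<B>) z = {{z}}" if "z \<in> V" "z \<notin> \<Union>\<B>" for z
    using that by (auto simp: containing_blocks_def with_singletons_def)
  show ?thesis
  proof (cases "\<exists>A\<in>\<B>. a \<in> A")
    case True
    then obtain A where A: "A \<in> \<B>" "a \<in> A" by blast
    show ?thesis
    proof (cases "\<exists>B\<in>\<B>. b \<in> B")
      case True
      then obtain B where "B \<in> \<B>" "b \<in> B" by blast
      with A show ?thesis using block block_family_unique[OF assms(1)] by (metis singleton_inject)
    next
      case False
      with A show ?thesis using block[OF A] single[OF assms(3)] by auto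
    qed
  next
    case False
    then show ?thesis using single[OF assms(2)] single[OF assms(3)] block by (cases "b \<in> \<Union>\<B>") auto
  qed
qed

lemma doubleton_in_lifted_multicut_iff:
  assumes P: "partition_on V P" and ab: "a \<in> V" "b \<in> V"
  shows "{a, b} \<in> lifted_multicut P \<longleftrightarrow> containing_blocks P a \<noteq> containing_blocks P b"
proof -
  obtain A B where AB: "A \<in> P" "B \<in> P" "a \<in> A" "b \<in> B"
    using partition_onD1[OF P] ab by blast
  note blocks = containing_blocks_partition[OF P]
  have "{a, b} \<in> lifted_multicut P \<longleftrightarrow> A \<noteq> B"
  proof
    assume "{a, b} \<in> lifted_multicut P"
    then obtain a' b' S T where "{a, b} = {a', b'}" "S \<in> P" "T \<in> P" "S \<noteq> T" "a' \<in> S" "b' \<in> T"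
      unfolding lifted_multicut_def by blast
    moreover have "a = a' \<and> b = b' \<or> a = b' \<and> b = a'"
      using calculation(1) by (auto simp: doubleton_eq_iff)
    ultimately show "A \<noteq> B" using AB blocks by (metis singleton_inject)
  next
    assume "A \<noteq> B"
    then show "{a, b} \<in> lifted_multicut P" unfolding lifted_multicut_def using AB by blast
  qed
  then show ?thesis using AB blocks by simp
qed

lemma lifted_multicut_subset_pairs:
  assumes "partition_on V P"
  shows "lifted_multicut P \<subseteq> pairs V"
proof
  fix e assume "e \<in> lifted_multicut P"
  then obtain a b A B where e: "e = {a, b}" "A \<in> P" "B \<in> P" "A \<noteq> B" "a \<in> A" "b \<in> B"
    unfolding lifted_multicut_def by blast
  moreover from e have "a \<noteq> b" using partition_onD2[OF assms] by (auto simp: disjoint_def)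
  ultimately show "e \<in> pairs V" using partition_onD1[OF assms] by (auto simp: doubleton_in_pairs_iff)
qed

lemma doubleton_in_lifted_multicut_with_singletons_iff:
  assumes "simple_graph V E" "block_family V E \<B>" "a \<in> V" "b \<in> V"
  shows "{a, b} \<in> lifted_multicut (with_singletons V \<B>) \<longleftrightarrow> a \<noteq> b \<and> \<not> (\<exists>B\<in>\<B>. a \<in> B \<and> b \<in> B)"
  using doubleton_in_lifted_multicut_iff[of V "with_singletons V \<B>" a b]
    decomposition_with_singletons[OF assms(1,2)] containing_blocks_with_singletons_eq_iff[OF assms(2-4)] assms
  by (simp add: decomposition_def)

subsection \<open>Colourings of an odd cycle\<close>

lemma sum_over_period:
  fixes F :: "int \<Rightarrow> 'a::ab_group_add"
  assumes "k > 0" and periodic: "\<And>i. F (i + k) = F i"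
  shows "(\<Sum>i\<in>{a..<a + k}. F i) = (\<Sum>i\<in>{0..<k}. F i)"
proof -
  have shift: "(\<Sum>i\<in>{a + 1..<a + 1 + k}. F i) = (\<Sum>i\<in>{a..<a + k}. F i)" for a
  proof -
    have "{a..<a + k} = insert a {a + 1..<a + k}" "{a + 1..<a + 1 + k} = insert (a + k) {a + 1..<a + k}"
      using assms(1) by auto
    then show ?thesis using periodic[of a] by simp
  qed
  show ?thesis
  proof (induction a rule: int_induct[where k = 0])
    case (step2 i)
    then show ?case using shift[of "i - 1"] by simp
  qed (use shift in auto)
qed

definition excess :: "int \<Rightarrow> int \<Rightarrow> (int \<Rightarrow> 'l) \<Rightarrow> int" where
  "excess k d g = (\<Sum>i\<in>{0..<k}. of_bool (g i \<noteq> g (i + d)) - of_bool (g i \<noteq> g (i + 1)))"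

text \<open>
  Size \<open>0\<close> stands for a missing interval: if the sizes add up to \<open>2 * d + 1\<close>, then the second disjunct
  describes two intervals of sizes \<open>d\<close> and \<open>d + 1\<close>.
\<close>

definition tight_sizes :: "int \<Rightarrow> int \<Rightarrow> int \<Rightarrow> int \<Rightarrow> bool" where
  "tight_sizes d a b c \<longleftrightarrow> a \<le> d \<and> b \<le> d \<and> c \<le> d \<or> {0, d} \<subseteq> {a, b, c}"

locale odd_cycle_colouring =
  fixes g :: "int \<Rightarrow> 'l" and k d :: int
  assumes periodic: "g (i + k) = g i" and k_eq: "k = 2 * d + 1" and d_pos: "1 \<le> d"
begin

definition monochromatic_chords :: "int set \<Rightarrow> int set" where
  "monochromatic_chords I = {i \<in> I. g i = g (i + d)}"

definition colour_changes :: "int set \<Rightarrow> int set" where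
  "colour_changes I = {i \<in> I. g i \<noteq> g (i + 1)}"

lemma finite_monochromatic_chords [simp]: "finite I \<Longrightarrow> finite (monochromatic_chords I)"
  by (simp add: monochromatic_chords_def)

lemma finite_colour_changes [simp]: "finite I \<Longrightarrow> finite (colour_changes I)"
  by (simp add: colour_changes_def)

lemma k_pos: "0 < k"
  using k_eq d_pos by simp

lemma colour_mod: "g (i mod k + e) = g (i + e)"
proof -
  interpret periodic_fun_simple g k by standard (rule periodic)
  show ?thesis using plus_of_int[of "i mod k + e" "i div k"] by (simp add: algebra_simps)
qed

lemma mod_in_monochromatic_chords_iff: "i mod k \<in> monochromatic_chords {0..<k} \<longleftrightarrow> g i = g (i + d)"
  using colour_mod[of i 0] colour_mod[of i d] k_pos by (simp add: monochromatic_chords_def)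

lemma mod_in_colour_changes_iff: "i mod k \<in> colour_changes {0..<k} \<longleftrightarrow> g i \<noteq> g (i + 1)"
  using colour_mod[of i 0] colour_mod[of i 1] k_pos by (simp add: colour_changes_def)

lemma colour_constant:
  assumes "\<And>i. g (i + 1) = g i"
  shows "g i = g j"
proof -
  have "g i = g 0" for i
    by (induction i rule: int_induct[where k = 0]) (use assms assms[of "_ - 1"] in auto)
  then show ?thesis by metis
qed

lemma excess_eq_card:
  "excess k d g = k - int (card (monochromatic_chords {a..<a + k})) - int (card (colour_changes {a..<a + k}))"
proof -
  have "excess k d g = (\<Sum>i\<in>{a..<a + k}. of_bool (g i \<noteq> g (i + d)) - of_bool (g i \<noteq> g (i + 1)))"
    unfolding excess_def
  proof (rule sum_over_period[symmetric, OF k_pos])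
    fix i
    have "g (i + k + e) = g (i + e)" for e using periodic[of "i + e"] by (simp add: algebra_simps)
    then show "of_bool (g (i + k) \<noteq> g (i + k + d)) - of_bool (g (i + k) \<noteq> g (i + k + 1)) =
        (of_bool (g i \<noteq> g (i + d)) - of_bool (g i \<noteq> g (i + 1)) :: int)"
      by (simp add: periodic)
  qed
  also have "\<dots> = (\<Sum>i\<in>{a..<a + k}. 1 - of_bool (g i = g (i + d)) - of_bool (g i \<noteq> g (i + 1)))"
    by (intro sum.cong) auto
  also have "\<dots> = k - int (card (monochromatic_chords {a..<a + k})) - int (card (colour_changes {a..<a + k}))"
    using k_pos by (simp add: sum_subtractf monochromatic_chords_def colour_changes_def Int_def)
  finally show ?thesis .
qed

lemma range_subset_image_colour_changes:
  assumes "colour_changes {0..<k} \<noteq> {}"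
  shows "range g \<subseteq> g ` colour_changes {0..<k}"
proof (rule ccontr)
  assume "\<not> ?thesis"
  then obtain j where j: "g j \<notin> g ` colour_changes {0..<k}" by blast
  have persist: "g (i + 1) = g j" if "g i = g j" for i
  proof (rule ccontr)
    assume "g (i + 1) \<noteq> g j"
    then have "i mod k \<in> colour_changes {0..<k}" using that by (simp add: mod_in_colour_changes_iff)
    then have "g (i mod k) \<in> g ` colour_changes {0..<k}" by (rule imageI)
    then show False using j that colour_mod[of i 0] by simp
  qed
  have forward: "g i = g j" if "j \<le> i" for i
    using that by (induction i rule: int_ge_induct) (auto intro: persist)
  have all_equal: "g i = g j" for i
  proof -
    have "j \<le> j + (i - j) mod k" using k_pos by simp
    then have "g (j + (i - j) mod k) = g j" by (rule forward)
    then show ?thesis using colour_mod[of "i - j" j] by (simp add: add.commute)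
  qed
  obtain i where "g i \<noteq> g (i + 1)" using assms by (auto simp: colour_changes_def)
  then show False using all_equal[of i] all_equal[of "i + 1"] by simp
qed

text \<open>The \<open>d\<close>-chords form an odd cycle, which has no proper colouring with two colours.\<close>

lemma monochromatic_chord_exists:
  assumes "finite (range g)" "card (range g) \<le> 2"
  shows "monochromatic_chords {0..<k} \<noteq> {}"
proof
  assume "monochromatic_chords {0..<k} = {}"
  then have chord: "g i \<noteq> g (i + d)" for i
    using mod_in_monochromatic_chords_iff[of i] by blast
  have adjacent_equal: "g (i + 1) = g i" for i
  proof (rule ccontr)
    assume "g (i + 1) \<noteq> g i"
    moreover have "g (i + 1) \<noteq> g (i + 1 + d)" by (rule chord)
    moreover have "g (i + 1 + d) \<noteq> g i"
      using chord[of "i + 1 + d"] periodic[of i] k_eq by (simp add: algebra_simps)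
    ultimately have "card {g i, g (i + 1), g (i + 1 + d)} = 3" by auto
    moreover have "card {g i, g (i + 1), g (i + 1 + d)} \<le> card (range g)"
      using assms(1) by (intro card_mono) auto
    ultimately show False using assms(2) by simp
  qed
  have "g 0 = g (0 + d)" using adjacent_equal by (rule colour_constant)
  then show False using chord[of 0] by simp
qed

lemma excess_le: "excess k d g \<le> k - 3"
proof -
  let ?D = "monochromatic_chords {0..<k}" and ?C = "colour_changes {0..<k}"
  have "3 \<le> card ?D + card ?C"
  proof (cases "?C = {}")
    case True
    then have "g (i + 1) = g i" for i using mod_in_colour_changes_iff[of i] by auto
    then have "g i = g (i + d)" for i by (rule colour_constant)
    then have "?D = {0..<k}" unfolding monochromatic_chords_def by blast
    then show ?thesis using k_eq d_pos by simp
  next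
    case False
    then have sub: "range g \<subseteq> g ` ?C" by (rule range_subset_image_colour_changes)
    then have colours: "finite (range g)" "card (range g) \<le> card ?C"
      using finite_subset[OF sub] surj_card_le[OF _ sub] by simp_all
    obtain i where "g i \<noteq> g (i + 1)" using False by (auto simp: colour_changes_def)
    then have "2 \<le> card (range g)"
      using card_mono[OF colours(1), of "{g i, g (i + 1)}"] by auto
    then have "2 \<le> card ?C" using colours(2) by simp
    moreover have "1 \<le> card ?D" if "card ?C = 2"
      using monochromatic_chord_exists[OF colours(1)] colours(2) that by (simp add: Suc_le_eq card_gt_0_iff)
    ultimately show ?thesis by linarith
  qed
  then show ?thesis using excess_eq_card[of 0] by simp
qed

context
  fixes i\<^sub>1 i\<^sub>2 i\<^sub>3 :: int
  assumes order: "i\<^sub>1 \<le> i\<^sub>2" "i\<^sub>2 \<le> i\<^sub>3" "i\<^sub>3 \<le> i\<^sub>1 + k"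
    and same: "\<And>i j. i\<^sub>1 \<le> i \<Longrightarrow> i \<le> j \<Longrightarrow> j < i\<^sub>1 + k \<Longrightarrow>
      g i = g j \<longleftrightarrow> j < i\<^sub>2 \<or> i\<^sub>2 \<le> i \<and> j < i\<^sub>3 \<or> i\<^sub>3 \<le> i"
begin

lemma colour_changes_subset_interval_ends: "colour_changes {i\<^sub>1..<i\<^sub>1 + k} \<subseteq> {i\<^sub>2 - 1, i\<^sub>3 - 1, i\<^sub>1 + k - 1} \<inter> {i\<^sub>1..}"
proof
  fix i assume i: "i \<in> colour_changes {i\<^sub>1..<i\<^sub>1 + k}"
  show "i \<in> {i\<^sub>2 - 1, i\<^sub>3 - 1, i\<^sub>1 + k - 1} \<inter> {i\<^sub>1..}"
  proof (cases "i + 1 < i\<^sub>1 + k")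
    case True
    then show ?thesis using i same[of i "i + 1"] by (auto simp: colour_changes_def)
  qed (use i in \<open>auto simp: colour_changes_def\<close>)
qed

lemma monochromatic_chord_in_long_interval:
  assumes i: "i \<in> monochromatic_chords {i\<^sub>1..<i\<^sub>1 + k}"
  shows "i \<in> {i\<^sub>1..<i\<^sub>2 - d} \<union> {i\<^sub>2..<i\<^sub>3 - d} \<union> {i\<^sub>3..<i\<^sub>1 + k - d} \<union>
    {i\<^sub>1 + d<..<i\<^sub>2} \<union> {i\<^sub>2 + d<..<i\<^sub>3} \<union> {i\<^sub>3 + d<..<i\<^sub>1 + k}"
proof (cases "i + d < i\<^sub>1 + k")
  case True
  then show ?thesis using i same[of i "i + d"] d_pos by (auto simp: monochromatic_chords_def)
next
  case False
  have "g (i + d) = g (i - d - 1)" using periodic[of "i - d - 1"] k_eq by (simp add: add.commute)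
  then show ?thesis
    using i False same[of "i - d - 1" i] d_pos k_eq by (auto simp: monochromatic_chords_def)
qed

lemma excess_intervals:
  assumes sizes: "tight_sizes d (i\<^sub>2 - i\<^sub>1) (i\<^sub>3 - i\<^sub>2) (i\<^sub>1 + k - i\<^sub>3)"
  shows "excess k d g = k - 3"
proof -
  let ?D = "monochromatic_chords {i\<^sub>1..<i\<^sub>1 + k}" and ?C = "colour_changes {i\<^sub>1..<i\<^sub>1 + k}"
  have "card ?D + card ?C \<le> 3"
  proof (cases "i\<^sub>2 - i\<^sub>1 \<le> d \<and> i\<^sub>3 - i\<^sub>2 \<le> d \<and> i\<^sub>1 + k - i\<^sub>3 \<le> d")
    case True
    then have "?D = {}" using monochromatic_chord_in_long_interval by fastforce
    moreover have "card ?C \<le> card {i\<^sub>2 - 1, i\<^sub>3 - 1, i\<^sub>1 + k - 1}"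
      using colour_changes_subset_interval_ends by (intro card_mono) auto
    moreover have "\<dots> \<le> 3" by (simp add: card_insert_if)
    ultimately show ?thesis by simp
  next
    case False
    then have two: "{0, d} \<subseteq> {i\<^sub>2 - i\<^sub>1, i\<^sub>3 - i\<^sub>2, i\<^sub>1 + k - i\<^sub>3}"
      using sizes by (auto simp: tight_sizes_def)
    define long_start where "long_start = (if i\<^sub>2 - i\<^sub>1 = d + 1 then i\<^sub>1 else if i\<^sub>3 - i\<^sub>2 = d + 1 then i\<^sub>2 else i\<^sub>3)"
    define inner_end where "inner_end = (if i\<^sub>1 = i\<^sub>2 then i\<^sub>3 - 1 else i\<^sub>2 - 1)"
    have "i\<^sub>2 - i\<^sub>1 = d + 1 \<and> i\<^sub>3 - i\<^sub>2 \<le> d \<and> i\<^sub>1 + k - i\<^sub>3 \<le> d \<or>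
        i\<^sub>2 - i\<^sub>1 \<le> d \<and> i\<^sub>3 - i\<^sub>2 = d + 1 \<and> i\<^sub>1 + k - i\<^sub>3 \<le> d \<or>
        i\<^sub>2 - i\<^sub>1 \<le> d \<and> i\<^sub>3 - i\<^sub>2 \<le> d \<and> i\<^sub>1 + k - i\<^sub>3 = d + 1"
      using two k_eq d_pos by auto
    then have "i = long_start" if "i \<in> ?D" for i
      using monochromatic_chord_in_long_interval[OF that] d_pos by (elim disjE) (auto simp: long_start_def)
    then have "card ?D \<le> card {long_start}" by (intro card_mono) auto
    moreover have "i \<in> {inner_end, i\<^sub>1 + k - 1}" if "i \<in> ?C" for i
      using subsetD[OF colour_changes_subset_interval_ends that] two order k_eq d_pos by (auto simp: inner_end_def)
    then have "card ?C \<le> card {inner_end, i\<^sub>1 + k - 1}" by (intro card_mono) auto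
    moreover have "\<dots> \<le> 2" by (simp add: card_insert_if)
    ultimately show ?thesis by simp
  qed
  then have "k - 3 \<le> excess k d g" using excess_eq_card[of i\<^sub>1] by simp
  then show ?thesis using excess_le by (rule antisym[rotated])
qed

end

lemma excess_reflect: "excess k d (\<lambda>i. g (- i)) = excess k d g"
proof -
  have "(\<Sum>i\<in>{0..<k}. of_bool (g (- i) \<noteq> g (- (i + e)))) = (\<Sum>i\<in>{0..<k}. of_bool (g i \<noteq> g (i + e)) :: int)"
    for e
  proof -
    have "g (i + k + e) = g (i + e)" for i using periodic[of "i + e"] by (simp add: algebra_simps)
    then have "(\<Sum>i\<in>{0..<k}. of_bool (g i \<noteq> g (i + e)) :: int) =
        (\<Sum>i\<in>{1 - e - k..<1 - e - k + k}. of_bool (g i \<noteq> g (i + e)))"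
      using periodic k_pos by (intro sum_over_period[symmetric]) auto
    also have "\<dots> = (\<Sum>i\<in>{0..<k}. of_bool (g (- i) \<noteq> g (- (i + e))))"
      by (rule sum.reindex_bij_witness[of _ "\<lambda>i. - (i + e)" "\<lambda>i. - (i + e)"]) (auto simp: add.commute)
    finally show ?thesis by simp
  qed
  then show ?thesis unfolding excess_def sum_subtractf by simp
qed

end

subsection \<open>Unrolled cycles and tight decompositions\<close>

text \<open>
  Positions on the cycle and indices of terminals are unrolled to the integers, so that cyclic arcs
  become images of integer intervals: \<open>w\<close> has period \<open>m\<close>, and \<open>q\<close> maps the index of a terminal to its
  position.
\<close>

locale unrolled_cycle =
  fixes V :: "'v set" and E :: "'v set set" and w :: "int \<Rightarrow> 'v" and m :: int
  assumes conn: "connected_graph V E" and m_pos: "0 < m"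
    and w_eq_iff: "w a = w b \<longleftrightarrow> m dvd a - b"
    and w_in: "w u \<in> V" and w_edge: "{w u, w (u + 1)} \<in> E"
begin

abbreviation arc :: "int \<Rightarrow> int \<Rightarrow> 'v set" where "arc a b \<equiv> w ` {a..b}"

lemma simple: "simple_graph V E"
  using conn by (simp add: connected_graph_def)

lemma w_inj: "w a = w b \<Longrightarrow> \<bar>a - b\<bar> < m \<Longrightarrow> a = b"
  using zdvd_imp_le[of m "\<bar>a - b\<bar>"] by (cases "a = b") (auto simp: w_eq_iff)

lemma arc_disjoint:
  assumes "b < c" "e < a + m"
  shows "arc a b \<inter> arc c e = {}"
proof -
  have False if "u \<in> {a..b}" "u' \<in> {c..e}" "w u = w u'" for u u'
    using w_inj[OF that(3)] that(1,2) assms by auto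
  then show ?thesis by blast
qed

lemma notin_arc_after: "u < a \<Longrightarrow> b < u + m \<Longrightarrow> w u \<notin> arc a b"
  using arc_disjoint[of u a b u] by auto

lemma notin_arc_before: "b < u \<Longrightarrow> u < a + m \<Longrightarrow> w u \<notin> arc a b"
  using arc_disjoint[of b u u a] by auto

lemma insert_arc_first: "a \<le> b \<Longrightarrow> insert (w a) (arc (a + 1) b) = arc a b"
  unfolding image_insert[symmetric] by (intro arg_cong[where f = "(`) w"]) auto

lemma insert_arc_last: "a \<le> b \<Longrightarrow> insert (w b) (arc a (b - 1)) = arc a b"
  unfolding image_insert[symmetric] by (intro arg_cong[where f = "(`) w"]) auto

lemma walk_arc: "walk E (map w [a..b])"
proof -
  have "{w (a + int n), w (1 + (a + int n))} \<in> E" for n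
    using w_edge[of "a + int n"] by (simp add: add.commute)
  then show ?thesis by (auto simp: successively_conv_nth algebra_simps)
qed

lemma connected_subset_arc: "connected_subset V E (arc a b)"
  using connected_subset_walk[OF simple walk_arc[of a b]] w_in by auto

lemma set_prefix_eq_arc:
  assumes "prefix xs (map w [a..b])" "a \<le> b + 1"
  obtains c where "a \<le> c + 1" "c \<le> b" "set xs = arc a c"
proof -
  have "a - 1 \<le> b" using assms(2) by simp
  then have "\<exists>c. a \<le> c + 1 \<and> c \<le> b \<and> us = [a..c]" if "prefix us [a..b]" for us
    using that
  proof (induction b rule: int_ge_induct)
    case (step b)
    then have "us = [a..b + 1] \<or> prefix us [a..b]"
      using upto_rec2[of a "b + 1"] by auto
    then show ?case using step by (force intro: exI[of _ "b + 1"])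
  qed (auto intro: exI[of _ "a - 1"])
  then show ?thesis using prefix_map_rightE[OF assms(1)] that by (metis set_map set_upto)
qed

lemma unrolled_cycle_reflected: "unrolled_cycle V E (\<lambda>u. w (- u)) m"
proof
  show "w (- a) = w (- b) \<longleftrightarrow> m dvd a - b" for a b
    using w_eq_iff[of "- a" "- b"] by (simp add: dvd_diff_commute)
  show "{w (- u), w (- (u + 1))} \<in> E" for u
    using w_edge[of "- u - 1"] by (simp add: insert_commute)
qed (fact conn m_pos w_in)+

text \<open>\<open>X\<close> lists the vertices visited before the cycle is reached, so it is empty if \<open>x\<close> lies on the cycle.\<close>

definition approach :: "'v \<Rightarrow> 'v list \<Rightarrow> int \<Rightarrow> bool" where
  "approach x X \<zeta> \<longleftrightarrow> walk E (X @ [w \<zeta>]) \<and> hd (X @ [w \<zeta>]) = x \<and> set X \<inter> range w = {} \<and>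
     x \<notin> set (tl (X @ [w \<zeta>]))"

lemma approach_cycle: "approach (w u) [] u"
  by (simp add: approach_def)

lemma approach_exists:
  assumes "x \<in> V"
  shows "\<exists>X \<zeta>. approach x X \<zeta>"
proof -
  have "(x, w 0) \<in> {(p, q). {p, q} \<in> E}\<^sup>*"
    using conn assms w_in by (auto simp: connected_graph_def)
  then show ?thesis
  proof (induction rule: converse_rtrancl_induct)
    case base
    then show ?case using approach_cycle by blast
  next
    case (step x x')
    then obtain X \<zeta> where X: "approach x' X \<zeta>" by blast
    have edge: "{x, x'} \<in> E" using step by simp
    consider (on_cycle) "x \<in> range w" | (new) "x \<notin> range w" "x \<notin> set X"
      | (visited) "x \<notin> range w" "x \<in> set X" by blast
    then show ?case
    proof cases
      case on_cycle
      then show ?thesis using approach_cycle by blast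
    next
      case new
      then have "approach x (x # X) \<zeta>" using X edge by (auto simp: approach_def successively_Cons)
      then show ?thesis by blast
    next
      case visited
      then obtain as bs where "X = as @ x # bs" "x \<notin> set bs" by (meson split_list_last)
      then have "approach x (x # bs) \<zeta>"
        using X visited by (auto simp: approach_def successively_append_iff)
      then show ?thesis by blast
    qed
  qed
qed

lemma approach_within_period:
  assumes "x \<in> V"
  obtains X \<zeta> where "approach x X \<zeta>" "u \<le> \<zeta>" "\<zeta> < u + m"
proof -
  obtain X \<zeta> where X: "approach x X \<zeta>" using approach_exists[OF assms] by blast
  have "w (u + (\<zeta> - u) mod m) = w \<zeta>" by (simp add: w_eq_iff mod_eq_dvd_iff[symmetric] mod_simps)
  then have "approach x X (u + (\<zeta> - u) mod m)" using X by (simp add: approach_def)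
  moreover have "0 \<le> (\<zeta> - u) mod m" "(\<zeta> - u) mod m < m" using m_pos by simp_all
  ultimately show ?thesis using that[of X "u + (\<zeta> - u) mod m"] by simp
qed

lemma walk_between_approaches:
  assumes X: "approach x X \<zeta>" and Y: "approach y Y \<eta>" and le: "\<zeta> \<le> \<eta>"
  shows "walk E (X @ map w [\<zeta>..\<eta>] @ rev Y)"
    and "hd (X @ map w [\<zeta>..\<eta>] @ rev Y) = x" and "last (X @ map w [\<zeta>..\<eta>] @ rev Y) = y"
proof -
  have "hd (map w [\<zeta>..\<eta>]) = w \<zeta>" by (simp only: upto_rec1[OF le] list.map list.sel)
  moreover have "last (map w [\<zeta>..\<eta>]) = w \<eta>" by (simp only: upto_rec2[OF le] map_append list.map last_snoc)
  ultimately have arc: "hd (map w [\<zeta>..\<eta>]) = w \<zeta>" "last (map w [\<zeta>..\<eta>]) = w \<eta>" "[\<zeta>..\<eta>] \<noteq> []"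
    using le by simp_all
  have "walk E (rev Y)" "Y \<noteq> [] \<Longrightarrow> {w \<eta>, last Y} \<in> E"
    using Y by (auto simp: approach_def successively_append_iff insert_commute)
  then have "walk E (map w [\<zeta>..\<eta>] @ rev Y)"
    using walk_arc[of \<zeta> \<eta>] arc by (auto simp: successively_append_iff hd_rev)
  then show "walk E (X @ map w [\<zeta>..\<eta>] @ rev Y)"
    using X arc by (auto simp: approach_def successively_append_iff)
  show "hd (X @ map w [\<zeta>..\<eta>] @ rev Y) = x"
    using X arc by (cases X) (auto simp: approach_def)
  show "last (X @ map w [\<zeta>..\<eta>] @ rev Y) = y"
    using Y arc by (cases Y) (auto simp: approach_def last_rev)
qed

lemma start_notin_tl_walk:
  assumes X: "approach x X \<zeta>" and "\<zeta> \<le> \<eta>" "\<eta> < \<zeta> + m" "x \<notin> set Y"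
  shows "x \<notin> set (tl (X @ map w [\<zeta>..\<eta>] @ rev Y))"
proof (cases X)
  case Nil
  then have "x \<notin> arc (\<zeta> + 1) \<eta>" using X assms(3) notin_arc_after[of \<zeta> "\<zeta> + 1" \<eta>] by (simp add: approach_def)
  then show ?thesis using Nil assms(4) by (simp add: upto_rec1[OF assms(2)])
next
  case (Cons a X')
  then show ?thesis using X assms(4) by (auto simp: approach_def)
qed

lemma prefix_inter_cycle_eq_arc:
  assumes X: "approach x X \<zeta>" and Y: "approach y Y \<eta>" and "\<zeta> \<le> \<eta>"
    and us: "prefix us (X @ map w [\<zeta>..\<eta>] @ rev Y)"
  obtains b where "\<zeta> \<le> b + 1" "b \<le> \<eta>" "set us \<inter> range w = arc \<zeta> b"
proof -
  have off_cycle: "set X \<inter> range w = {}" "set Y \<inter> range w = {}" using X Y by (simp_all add: approach_def)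
  consider (before) "prefix us X" | (along) vs where "us = X @ vs" "prefix vs (map w [\<zeta>..\<eta>])"
    | (after) vs where "us = X @ map w [\<zeta>..\<eta>] @ vs" "prefix vs (rev Y)"
    using us unfolding prefix_append by blast
  then show ?thesis
  proof cases
    case before
    then have "set us \<inter> range w = arc \<zeta> (\<zeta> - 1)" using off_cycle(1) set_mono_prefix by fastforce
    then show ?thesis using that[of "\<zeta> - 1"] \<open>\<zeta> \<le> \<eta>\<close> by simp
  next
    case along
    obtain b where b: "\<zeta> \<le> b + 1" "b \<le> \<eta>" "set vs = arc \<zeta> b"
      using set_prefix_eq_arc[OF along(2)] \<open>\<zeta> \<le> \<eta>\<close> by auto
    then have "set us \<inter> range w = arc \<zeta> b" using along(1) off_cycle(1) by auto
    then show ?thesis using that b by blast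
  next
    case after
    then have "set us \<inter> range w = arc \<zeta> \<eta>" using off_cycle set_mono_prefix[OF after(2)] by auto
    then show ?thesis using that[of \<eta>] \<open>\<zeta> \<le> \<eta>\<close> by simp
  qed
qed

end

locale cyclic_terminals = unrolled_cycle V E w m
  for V :: "'v set" and E :: "'v set set" and w :: "int \<Rightarrow> 'v" and m :: int +
  fixes q :: "int \<Rightarrow> int" and k d :: int
  assumes k_eq: "k = 2 * d + 1" and d_ge: "2 \<le> d"
    and q_mono: "strict_mono q" and q_period: "q (i + k) = q i + m"
begin

abbreviation v :: "int \<Rightarrow> 'v" where "v i \<equiv> w (q i)"

definition tight :: "'v set set \<Rightarrow> bool" where
  "tight P \<longleftrightarrow> excess k d (\<lambda>i. containing_blocks P (v i)) = k - 3"

lemma q_less_iff [simp]: "q i < q j \<longleftrightarrow> i < j"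
  using q_mono by (rule strict_mono_less)

lemma q_le_iff [simp]: "q i \<le> q j \<longleftrightarrow> i \<le> j"
  using q_mono by (rule strict_mono_less_eq)

lemma v_period: "v (i + k) = v i"
  by (simp add: q_period w_eq_iff)

lemma v_mod: "v (i mod k) = v i"
proof -
  interpret periodic_fun_simple v k by standard (rule v_period)
  show ?thesis using plus_of_int[of "i mod k" "i div k"] by simp
qed

lemma odd_cycle_colouring_containing_blocks: "odd_cycle_colouring (\<lambda>i. containing_blocks P (v i)) k d"
  using k_eq d_ge v_period by unfold_locales simp_all

lemma v_distinct: "i < j \<Longrightarrow> j < i + k \<Longrightarrow> v i \<noteq> v j"
proof
  assume "i < j" "j < i + k" "v i = v j"
  then show False using w_inj[of "q i" "q j"] q_less_iff[of i j] q_less_iff[of j "i + k"]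
    by (auto simp: q_period simp del: q_less_iff)
qed

lemma index_exists:
  obtains i where "q (i - 1) < u" "u \<le> q i"
proof -
  have growth: "j - i \<le> q j - q i" if "i \<le> j" for i j
    using that
  proof (induction j rule: int_ge_induct)
    case (step j)
    then show ?case using q_less_iff[of j "j + 1"] by linarith
  qed simp
  define a where "a = - (\<bar>u\<bar> + \<bar>q 0\<bar> + 1)"
  have "a \<le> 0" by (simp add: a_def)
  then have "q a < u" "u \<le> q (- a)" using growth[of a 0] growth[of 0 "- a"] unfolding a_def by linarith+
  have "u \<le> q b \<Longrightarrow> \<exists>i. q (i - 1) < u \<and> u \<le> q i" if "a \<le> b" for b
    using that
  proof (induction b rule: int_ge_induct)
    case base
    then show ?case using \<open>q a < u\<close> by simp
  next
    case (step b)
    then show ?case by (cases "u \<le> q b") (auto intro: exI[of _ "b + 1"])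
  qed
  from this[of "- a"] show ?thesis using \<open>u \<le> q (- a)\<close> \<open>a \<le> 0\<close> that by auto
qed

lemma q_period_mult: "q (i + k * s) = q i + m * s"
proof (induction s rule: int_induct[where k = 0])
  case (step1 s)
  then show ?case using q_period[of "i + k * s"] by (simp add: algebra_simps)
next
  case (step2 s)
  then show ?case using q_period[of "i + k * (s - 1)"] by (simp add: algebra_simps)
qed simp

lemma terminal_position:
  assumes "w u \<in> range v"
  obtains l where "u = q l"
proof -
  from assms obtain j where "w u = v j" by blast
  then obtain s where "u - q j = m * s" by (auto simp: w_eq_iff)
  then have "u = q (j + k * s)" by (simp add: q_period_mult)
  then show ?thesis by (rule that)
qed

lemma tight_with_singletons:
  assumes family: "block_family V E \<B>"
    and blocks: "\<And>l. i\<^sub>1 \<le> l \<Longrightarrow> l < i\<^sub>2 \<Longrightarrow> v l \<in> A" "\<And>l. i\<^sub>2 \<le> l \<Longrightarrow> l < i\<^sub>3 \<Longrightarrow> v l \<in> B"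
      "\<And>l. i\<^sub>3 \<le> l \<Longrightarrow> l < i\<^sub>1 + k \<Longrightarrow> v l \<in> C"
    and members: "{A, B, C} \<subseteq> \<B>" and disjoint: "A \<inter> B = {}" "A \<inter> C = {}" "B \<inter> C = {}"
    and order: "i\<^sub>1 \<le> i\<^sub>2" "i\<^sub>2 \<le> i\<^sub>3" "i\<^sub>3 \<le> i\<^sub>1 + k"
    and sizes: "tight_sizes d (i\<^sub>2 - i\<^sub>1) (i\<^sub>3 - i\<^sub>2) (i\<^sub>1 + k - i\<^sub>3)"
  shows "tight (with_singletons V \<B>)"
proof -
  interpret odd_cycle_colouring "\<lambda>i. containing_blocks (with_singletons V \<B>) (v i)" k d
    by (rule odd_cycle_colouring_containing_blocks)
  define part where "part l = (if l < i\<^sub>2 then A else if l < i\<^sub>3 then B else C)" for l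
  have part: "v l \<in> part l" "part l \<in> \<B>" if "i\<^sub>1 \<le> l" "l < i\<^sub>1 + k" for l
    using that blocks members by (auto simp: part_def)
  show ?thesis
    unfolding tight_def
  proof (rule excess_intervals[OF order _ sizes])
    fix i j assume ij: "i\<^sub>1 \<le> i" "i \<le> j" "j < i\<^sub>1 + k"
    then have in_part: "v i \<in> part i" "v j \<in> part j" "part i \<in> \<B>" "part j \<in> \<B>" by (auto intro: part)
    then have "containing_blocks (with_singletons V \<B>) (v i) = containing_blocks (with_singletons V \<B>) (v j)
        \<longleftrightarrow> part i = part j"
      unfolding containing_blocks_with_singletons_eq_iff[OF family w_in w_in]
      using block_family_unique[OF family] by metis
    also have "\<dots> \<longleftrightarrow> j < i\<^sub>2 \<or> i\<^sub>2 \<le> i \<and> j < i\<^sub>3 \<or> i\<^sub>3 \<le> i"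
      using in_part(1,2) disjoint order ij by (auto simp: part_def split: if_splits)
    finally show "containing_blocks (with_singletons V \<B>) (v i) = containing_blocks (with_singletons V \<B>) (v j)
        \<longleftrightarrow> j < i\<^sub>2 \<or> i\<^sub>2 \<le> i \<and> j < i\<^sub>3 \<or> i\<^sub>3 \<le> i" .
  qed
qed

lemma cyclic_terminals_reflected: "cyclic_terminals V E (\<lambda>u. w (- u)) m (\<lambda>i. - q (- i)) k d"
proof (rule cyclic_terminals.intro[OF unrolled_cycle_reflected], unfold_locales)
  show "strict_mono (\<lambda>i. - q (- i))" by (rule strict_monoI) simp
  show "- q (- (i + k)) = - q (- i) + m" for i using q_period[of "- i - k"] by simp
qed (fact k_eq d_ge)+

lemma tight_reflected: "cyclic_terminals.tight (\<lambda>u. w (- u)) (\<lambda>i. - q (- i)) k d P \<longleftrightarrow> tight P"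
  using cyclic_terminals.tight_def[OF cyclic_terminals_reflected, of P]
    odd_cycle_colouring.excess_reflect[OF odd_cycle_colouring_containing_blocks, of P]
  by (simp add: tight_def)

lemma tight_decomposition_exists: "\<exists>P. decomposition V E P \<and> tight P"
proof -
  define A where "A = arc (q 0) (q (d - 1))"
  define B where "B = arc (q d) (q (2 * d))"
  have "A \<inter> B = {}"
    unfolding A_def B_def using q_period[of 0] q_less_iff[of "2 * d" k] k_eq by (intro arc_disjoint) auto
  then have family: "block_family V E {A, B, {}}"
    using connected_subset_arc unfolding A_def B_def by (intro block_family_insertI) auto
  have "tight (with_singletons V {A, B, {}})"
    by (rule tight_with_singletons[OF family, of 0 d A k B "{}"])
      (use \<open>A \<inter> B = {}\<close> k_eq d_ge in \<open>auto simp: tight_sizes_def A_def B_def\<close>)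
  then show ?thesis using decomposition_with_singletons[OF simple family] by blast
qed

end

subsection \<open>Weights with constant sum over tight multicuts\<close>

locale tight_weights = cyclic_terminals V E w m q k d
  for V :: "'v set" and E :: "'v set set" and w :: "int \<Rightarrow> 'v" and m :: int
    and q :: "int \<Rightarrow> int" and k d :: int +
  fixes \<alpha> :: "'v set \<Rightarrow> real" and \<kappa> :: real
  assumes sum_tight: "decomposition V E P \<Longrightarrow> tight P \<Longrightarrow> sum \<alpha> (lifted_multicut P) = \<kappa>"
begin

lemma sum_weights_move:
  assumes before: "block_family V E (insert (insert x M) (insert N \<R>))"
      "tight (with_singletons V (insert (insert x M) (insert N \<R>)))"
    and after: "block_family V E (insert M (insert (insert x N) \<R>))"
      "tight (with_singletons V (insert M (insert (insert x N) \<R>)))"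
    and x: "x \<notin> M" "x \<notin> N"
  shows "(\<Sum>z\<in>M. \<alpha> {x, z}) = (\<Sum>z\<in>N. \<alpha> {x, z})"
proof -
  let ?before = "insert (insert x M) (insert N \<R>)" and ?after = "insert M (insert (insert x N) \<R>)"
  let ?cut = "\<lambda>\<B>. lifted_multicut (with_singletons V \<B>)"
  have xV: "x \<in> V" using block_family_Union_subset[OF before(1)] by auto
  have finite: "finite V" using simple by (simp add: simple_graph_def)
  note decomposition = decomposition_with_singletons[OF simple]
  note cut_iff = doubleton_in_lifted_multicut_with_singletons_iff[OF simple]
  have uncut: "{z. z \<in> V - {x} \<and> {x, z} \<notin> ?cut \<B>} = B - {x}"
    if "block_family V E \<B>" "B \<in> \<B>" "x \<in> B" for \<B> B
    using that cut_iff[OF that(1) xV] block_family_Union_subset[OF that(1)]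
      block_family_unique[OF that(1,2) _ that(3)] by blast
  have "(\<Sum>z | z \<in> V - {x} \<and> {x, z} \<notin> ?cut ?before. \<alpha> {x, z}) =
      (\<Sum>z | z \<in> V - {x} \<and> {x, z} \<notin> ?cut ?after. \<alpha> {x, z})"
  proof (rule sum_uncut_incident_eq[OF finite xV])
    show "?cut ?before \<subseteq> pairs V" "?cut ?after \<subseteq> pairs V"
      using decomposition[OF before(1)] decomposition[OF after(1)] lifted_multicut_subset_pairs
      by (auto simp: decomposition_def)
    show "sum \<alpha> (?cut ?before) = sum \<alpha> (?cut ?after)"
      using sum_tight[OF decomposition before(2)] sum_tight[OF decomposition after(2)] before(1) after(1)
      by simp
    fix e assume "e \<in> pairs (V - {x})"
    then obtain a b where "e = {a, b}" "a \<in> V - {x}" "b \<in> V - {x}" by (rule pairs_cases)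
    then show "e \<in> ?cut ?before \<longleftrightarrow> e \<in> ?cut ?after"
      using cut_iff[OF before(1), of a b] cut_iff[OF after(1), of a b] by auto
  qed
  then show ?thesis
    using uncut[OF before(1), of "insert x M"] uncut[OF after(1), of "insert x N"] x by simp
qed

definition meets_short_interval :: "'v set \<Rightarrow> bool" where
  "meets_short_interval S \<longleftrightarrow> (\<exists>i t. 0 \<le> t \<and> t \<le> d + 1 \<and> (\<forall>l. i \<le> l \<and> l < i + t \<longrightarrow> v l \<in> S) \<and>
     S \<inter> arc (q (i + t)) (q (i + k - 1)) = {})"

lemma meets_short_interval_arc:
  assumes S: "S \<inter> range w = arc a b" and "a \<le> b + 1" and i: "q (i - 1) < a" "a \<le> q i" "b < q (i + d + 1)"
  shows "meets_short_interval S"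
proof -
  obtain j where j: "q (j - 1) < b + 1" "b + 1 \<le> q j" by (rule index_exists)
  have "q (i - 1) < q j" "q (j - 1) < q (i + d + 1)" using assms j by linarith+
  then have ij: "i \<le> j" "j \<le> i + d + 1" by simp_all
  have "v l \<in> S" if "i \<le> l" "l < j" for l
  proof -
    have "q i \<le> q l" "q l \<le> q (j - 1)" using that by simp_all
    then have "a \<le> q l" "q l \<le> b" using i j by linarith+
    then have "v l \<in> arc a b" by simp
    then show ?thesis using S by blast
  qed
  moreover have "arc a b \<inter> arc (q j) (q (i + k - 1)) = {}"
    using i j q_period[of "i - 1"] by (intro arc_disjoint) (auto simp: algebra_simps)
  then have "S \<inter> arc (q j) (q (i + k - 1)) = {}" using S by blast
  ultimately show ?thesis
    unfolding meets_short_interval_def using ij by (intro exI[of _ i] exI[of _ "j - i"]) auto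
qed

text \<open>\<open>x\<close> becomes a singleton while the terminals outside \<open>M\<close> form two further blocks.\<close>

lemma sum_weights_nonterminal_eq_zero:
  assumes x: "x \<notin> range v" "x \<notin> M"
    and conn: "connected_subset V E M" "connected_subset V E (insert x M)"
    and "meets_short_interval (insert x M)"
  shows "(\<Sum>z\<in>M. \<alpha> {x, z}) = 0"
proof -
  obtain i t where t: "0 \<le> t" "t \<le> d + 1"
    and inside: "\<And>l. i \<le> l \<Longrightarrow> l < i + t \<Longrightarrow> v l \<in> insert x M"
    and outside: "insert x M \<inter> arc (q (i + t)) (q (i + k - 1)) = {}"
    using \<open>meets_short_interval (insert x M)\<close> unfolding meets_short_interval_def by blast
  have in_M: "v l \<in> M" if "i \<le> l" "l < i + t" for l using inside[OF that] x(1) by blast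
  define B where "B = arc (q (i + t)) (q (i + t + d - 1))"
  define C where "C = arc (q (i + t + d)) (q (i + k - 1))"
  have "B \<subseteq> arc (q (i + t)) (q (i + k - 1))" "C \<subseteq> arc (q (i + t)) (q (i + k - 1))"
    unfolding B_def C_def by (intro image_mono; use d_ge k_eq t in auto)+
  then have disjoint: "insert x M \<inter> B = {}" "insert x M \<inter> C = {}" using outside by blast+
  have disjoint_BC: "B \<inter> C = {}"
    unfolding B_def C_def using q_less_iff[of "i + k - 1" "i + t + k"] t d_ge
    by (intro arc_disjoint) (auto simp: q_period)
  have in_B: "v l \<in> B" if "i + t \<le> l" "l < i + t + d" for l using that by (auto simp: B_def)
  have in_C: "v l \<in> C" if "i + t + d \<le> l" "l < i + k" for l using that by (auto simp: C_def)
  have sizes: "tight_sizes d (i + t - i) (i + t + d - (i + t)) (i + k - (i + t + d))"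
    using t k_eq by (auto simp: tight_sizes_def)
  have "x \<in> V" using conn(2) by (simp add: connected_subset_def)
  then have connected_blocks: "connected_subset V E {x}" "connected_subset V E B" "connected_subset V E C"
    unfolding B_def C_def by (simp_all add: connected_subset_singleton[OF simple] connected_subset_arc)
  have before: "block_family V E {insert x M, {}, B, C}" and after: "block_family V E {M, {x}, B, C}"
    using conn connected_blocks disjoint disjoint_BC x(2) by (intro block_family_insertI; auto)+
  have "(\<Sum>z\<in>M. \<alpha> {x, z}) = (\<Sum>z\<in>{}. \<alpha> {x, z})"
  proof (rule sum_weights_move[OF before _ after])
    show "tight (with_singletons V {insert x M, {}, B, C})"
      by (rule tight_with_singletons[OF before, of i "i + t" "insert x M" "i + t + d" B C])
        (use disjoint disjoint_BC in_M in_B in_C sizes t k_eq d_ge in auto)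
    show "tight (with_singletons V {M, {x}, B, C})"
      by (rule tight_with_singletons[OF after, of i "i + t" M "i + t + d" B C])
        (use disjoint disjoint_BC in_M in_B in_C sizes t k_eq d_ge in auto)
  qed (use x in auto)
  then show ?thesis by simp
qed

lemma weight_zero_along_walk:
  assumes "walk E (x # xs)" "x \<in> V" "x \<notin> set xs" "x \<notin> range v"
    and "\<And>ys. prefix ys xs \<Longrightarrow> meets_short_interval (insert x (set ys))"
    and "z \<in> set xs"
  shows "\<alpha> {x, z} = 0"
  using assms
proof (induction xs arbitrary: z rule: rev_induct)
  case (snoc y xs)
  have "walk E (x # xs)" using snoc.prems(1) successively_append_iff[of _ "x # xs" "[y]"] by simp
  have "walk E (xs @ [y])" using snoc.prems(1) by (auto simp: successively_Cons)
  have IH: "\<alpha> {x, u} = 0" if "u \<in> set xs" for u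
    by (rule snoc.IH) (use snoc.prems that \<open>walk E (x # xs)\<close> in auto)
  have "connected_subset V E (set (xs @ [y]))" "connected_subset V E (set (x # xs @ [y]))"
    using snoc.prems(1,2) \<open>walk E (xs @ [y])\<close> walk_subset[OF simple snoc.prems(1,2)]
    by (intro connected_subset_walk[OF simple]; simp)+
  then have "(\<Sum>u\<in>set (xs @ [y]). \<alpha> {x, u}) = 0"
    using snoc.prems(3,4) snoc.prems(5)[of "xs @ [y]"] by (intro sum_weights_nonterminal_eq_zero) auto
  moreover have "(\<Sum>u\<in>set (xs @ [y]). \<alpha> {x, u}) = (\<Sum>u\<in>{y}. \<alpha> {x, u})"
    using IH by (intro sum.mono_neutral_right) auto
  ultimately show ?case using IH snoc.prems(6) by auto
qed simp

lemma weight_zero_on_approach: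
  assumes Y: "approach y Y \<eta>" and x: "x \<in> V" "x \<in> set Y" "x \<noteq> y"
  shows "\<alpha> {x, y} = 0"
proof -
  have off_cycle: "set Y \<inter> range w = {}" using Y by (simp add: approach_def)
  obtain ys zs where Y_split: "Y = ys @ x # zs" "x \<notin> set ys" using x(2) by (meson split_list_first)
  show ?thesis
  proof (rule weight_zero_along_walk)
    show "walk E (x # rev ys)" "y \<in> set (rev ys)"
      using Y Y_split x(3)
      by (auto simp: approach_def successively_append_iff successively_Cons hd_rev insert_commute hd_append
          split: if_splits)
    show "x \<notin> range v" using off_cycle x(2) by auto
    fix us assume "prefix us (rev ys)"
    then have "insert x (set us) \<subseteq> set Y" using set_mono_prefix[of us "rev ys"] Y_split by auto
    then have "insert x (set us) \<inter> range w = arc (q 0) (q 0 - 1)" using off_cycle by auto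
    moreover have "q 0 - 1 < q (0 + d + 1)" using q_less_iff[of 0 "d + 1"] d_ge by (simp del: q_less_iff)
    ultimately show "meets_short_interval (insert x (set us))"
      using d_ge by (intro meets_short_interval_arc[of _ "q 0" "q 0 - 1" 0]) (auto simp: add1_zle_eq)
  qed (use x Y_split in auto)
qed

lemma weight_zero_ahead:
  assumes X: "approach x X \<zeta>" and Y: "approach y Y \<eta>" and x: "x \<in> V" "x \<notin> range v" "x \<noteq> y"
    and le: "\<zeta> \<le> \<eta>" and i: "q (i - 1) < \<zeta>" "\<zeta> \<le> q i" "\<eta> < q (i + d + 1)"
  shows "\<alpha> {x, y} = 0"
proof (cases "x \<in> set Y")
  case True
  then show ?thesis using weight_zero_on_approach[OF Y] x by blast
next
  case False
  let ?W = "X @ map w [\<zeta>..\<eta>] @ rev Y"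
  note W = walk_between_approaches[OF X Y le]
  have "?W \<noteq> []" using le by simp
  then obtain xs where xs: "?W = x # xs" using W(2) by (metis list.collapse)
  show ?thesis
  proof (rule weight_zero_along_walk)
    show "walk E (x # xs)" using W(1) xs by simp
    show "y \<in> set xs" using W(3) xs x(3) by (metis last_ConsL last_ConsR last_in_set)
    have "q (i + d + 1) \<le> q (i - 1 + k)" using k_eq d_ge by simp
    then have "\<eta> < \<zeta> + m" using i unfolding q_period by linarith
    then show "x \<notin> set xs" using start_notin_tl_walk[OF X le _ False] xs by simp
    fix us assume "prefix us xs"
    then have "prefix (x # us) ?W" unfolding xs by simp
    then obtain b where "\<zeta> \<le> b + 1" "b \<le> \<eta>" "set (x # us) \<inter> range w = arc \<zeta> b"
      by (rule prefix_inter_cycle_eq_arc[OF X Y le])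
    then show "meets_short_interval (insert x (set us))" using i by (intro meets_short_interval_arc[of _ \<zeta> b]) auto
  qed (use x in auto)
qed

lemma tight_weights_reflected: "tight_weights V E (\<lambda>u. w (- u)) m (\<lambda>i. - q (- i)) k d \<alpha> \<kappa>"
proof -
  interpret R: cyclic_terminals V E "\<lambda>u. w (- u)" m "\<lambda>i. - q (- i)" k d by (rule cyclic_terminals_reflected)
  show ?thesis by unfold_locales (simp add: tight_reflected sum_tight)
qed

lemma weight_zero_nonterminal:
  assumes x: "x \<in> V" "x \<notin> range v" and y: "y \<in> V" "x \<noteq> y"
  shows "\<alpha> {x, y} = 0"
proof -
  obtain X \<zeta> where X: "approach x X \<zeta>" using approach_exists[OF x(1)] by blast
  obtain Y \<eta> where Y: "approach y Y \<eta>" "\<zeta> \<le> \<eta>" "\<eta> < \<zeta> + m" using approach_within_period[OF y(1)] .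
  obtain i where i: "q (i - 1) < \<zeta>" "\<zeta> \<le> q i" by (rule index_exists)
  show ?thesis
  proof (cases "\<eta> < q (i + d + 1)")
    case True
    then show ?thesis using weight_zero_ahead[OF X Y(1) x y(2) Y(2) i] by blast
  next
    \<comment> \<open>More than \<open>d + 1\<close> terminals lie ahead on the way to \<open>y\<close>, hence at most \<open>d + 1\<close> on the way back.\<close>
    case False
    interpret R: tight_weights V E "\<lambda>u. w (- u)" m "\<lambda>i. - q (- i)" k d \<alpha> \<kappa>
      by (rule tight_weights_reflected)
    have range_reflect: "range (\<lambda>u. f (- u)) = range f" for f :: "int \<Rightarrow> 'v"
      using image_image[of f uminus UNIV] by simp
    have approach_eq: "R.approach z Z u \<longleftrightarrow> approach z Z (- u)" for z Z u
      by (simp add: R.approach_def approach_def range_reflect)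
    obtain j where j: "- q (- (j - 1)) < - \<zeta>" "- \<zeta> \<le> - q (- j)" by (rule R.index_exists)
    have "q (- j) \<le> q i" using i j by linarith
    then have "- j \<le> i" by simp
    then have "q (- (j + d + 1)) < q (i + d + 1 - k)" using k_eq by simp
    moreover have "q (i + d + 1) = q (i + d + 1 - k) + m" using q_period[of "i + d + 1 - k"] by simp
    ultimately have "m - \<eta> < - q (- (j + d + 1))" using False by linarith
    moreover have "w (\<eta> - m) = w \<eta>" by (simp add: w_eq_iff)
    then have "R.approach y Y (m - \<eta>)" using Y(1) by (simp add: approach_eq approach_def)
    moreover have "R.approach x X (- \<zeta>)" using X by (simp add: approach_eq)
    ultimately show ?thesis
      using range_reflect[of v] x y Y j by (intro R.weight_zero_ahead[of x X "- \<zeta>" y Y "m - \<eta>" j]) auto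
  qed
qed

lemma sum_weights_arc_terminals:
  assumes x: "x \<in> V" "x \<notin> arc a b" and "b < a + m" and terminals: "\<And>l. a \<le> q l \<and> q l \<le> b \<longleftrightarrow> l \<in> I"
  shows "(\<Sum>z\<in>arc a b. \<alpha> {x, z}) = (\<Sum>l\<in>I. \<alpha> {x, v l})"
proof -
  have "v ` I = arc a b \<inter> range v"
  proof (intro equalityI subsetI)
    fix z assume z: "z \<in> arc a b \<inter> range v"
    then obtain u where u: "u \<in> {a..b}" "z = w u" by blast
    then have "w u \<in> range v" using z by simp
    then obtain l where "u = q l" by (rule terminal_position)
    then show "z \<in> v ` I" using u terminals[of l] by auto
  qed (use terminals in auto)
  moreover have "inj_on v I"
  proof (rule inj_onI)
    fix l l' assume "l \<in> I" "l' \<in> I" "v l = v l'"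
    then have "q l = q l'" using terminals[of l] terminals[of l'] \<open>b < a + m\<close> by (intro w_inj) auto
    then show "l = l'" using strict_mono_eq[OF q_mono] by simp
  qed
  ultimately have "(\<Sum>l\<in>I. \<alpha> {x, v l}) = (\<Sum>z\<in>arc a b \<inter> range v. \<alpha> {x, z})"
    by (metis sum.reindex_cong)
  also have "\<dots> = (\<Sum>z\<in>arc a b. \<alpha> {x, z})"
  proof (rule sum.mono_neutral_left)
    show "\<forall>z\<in>arc a b - arc a b \<inter> range v. \<alpha> {x, z} = 0"
      using weight_zero_nonterminal[of _ x] w_in x by (auto simp: insert_commute)
  qed auto
  finally show ?thesis by simp
qed

lemma sum_weights_arc_after:
  assumes "0 \<le> p" "p < k"
  shows "(\<Sum>z\<in>arc (q i + 1) (q (i + p)). \<alpha> {v i, z}) = (\<Sum>l\<in>{i + 1..i + p}. \<alpha> {v i, v l})"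
proof (rule sum_weights_arc_terminals)
  have "q (i + p) < q i + m" using assms by (simp flip: q_period)
  then show "v i \<notin> arc (q i + 1) (q (i + p))" "q (i + p) < q i + 1 + m"
    by (rule notin_arc_after[rotated], simp, linarith)
qed (auto simp: w_in add1_zle_eq)

lemma sum_weights_arc_before:
  assumes "0 \<le> r" "r < k"
  shows "(\<Sum>z\<in>arc (q (i - r)) (q i - 1). \<alpha> {v i, z}) = (\<Sum>l\<in>{i - r..i - 1}. \<alpha> {v i, v l})"
proof (rule sum_weights_arc_terminals)
  have "q i < q (i - r) + m" using assms by (simp flip: q_period)
  then show "v i \<notin> arc (q (i - r)) (q i - 1)" "q i - 1 < q (i - r) + m"
    by (rule notin_arc_before[rotated], simp, linarith)
qed (auto simp: w_in)

text \<open>\<open>v i\<close> moves from the front of the block \<open>v i, \<dots>, v (i + p)\<close> to the end of \<open>v (i - r), \<dots>, v (i - 1)\<close>.\<close>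

lemma sum_weights_terminal_balance:
  assumes pr: "0 \<le> p" "0 \<le> r" "p + r \<le> 2 * d"
    and sizes: "tight_sizes d r (p + 1) (2 * d - p - r)" "tight_sizes d (r + 1) p (2 * d - p - r)"
  shows "(\<Sum>l\<in>{i + 1..i + p}. \<alpha> {v i, v l}) = (\<Sum>l\<in>{i - r..i - 1}. \<alpha> {v i, v l})"
proof -
  define M where "M = arc (q i + 1) (q (i + p))"
  define N where "N = arc (q (i - r)) (q i - 1)"
  define B where "B = arc (q (i + p + 1)) (q (i - r + k - 1))"
  have order: "q i \<le> q (i + p)" "q (i + p) < q (i + p + 1)" "q (i - r) \<le> q i"
    "q (i + p) < q (i - r) + m" "q (i - r + k - 1) < q (i - r) + m"
    using pr k_eq by (simp_all flip: q_period)
  have xM: "insert (v i) M = arc (q i) (q (i + p))" and xN: "insert (v i) N = arc (q (i - r)) (q i)"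
    unfolding M_def N_def using order by (intro insert_arc_first insert_arc_last; linarith)+
  have connected: "connected_subset V E D" if "D \<in> {insert (v i) M, M, insert (v i) N, N, B}" for D
    using that connected_subset_arc unfolding xM xN unfolding M_def N_def B_def by blast
  have disjoint: "N \<inter> insert (v i) M = {}" "insert (v i) M \<inter> B = {}" "insert (v i) N \<inter> M = {}"
    "insert (v i) N \<inter> B = {}"
    unfolding xM xN unfolding M_def N_def B_def using order by (intro arc_disjoint; linarith)+
  have before: "block_family V E {insert (v i) M, N, B}" and after: "block_family V E {M, insert (v i) N, B}"
    using connected disjoint by (intro block_family_insertI; auto)+
  have in_M: "v l \<in> M" if "i + 1 \<le> l" "l < i + p + 1" for l
    using that by (simp add: M_def add1_zle_eq)
  have in_xM: "v l \<in> insert (v i) M" if "i \<le> l" "l < i + p + 1" for l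
    unfolding xM using that by simp
  have in_N: "v l \<in> N" if "i - r \<le> l" "l < i" for l
    using that by (simp add: N_def)
  have in_xN: "v l \<in> insert (v i) N" if "i - r \<le> l" "l < i + 1" for l
    unfolding xN using that by simp
  have in_B: "v l \<in> B" if "i + p + 1 \<le> l" "l < i - r + k" for l
    using that by (simp add: B_def)
  have "(\<Sum>z\<in>M. \<alpha> {v i, z}) = (\<Sum>z\<in>N. \<alpha> {v i, z})"
  proof (rule sum_weights_move[OF before _ after])
    show "tight (with_singletons V {insert (v i) M, N, B})"
      by (rule tight_with_singletons[OF before, of "i - r" i N "i + p + 1" "insert (v i) M" B])
        (fact in_N in_xM in_B | use pr sizes disjoint k_eq in auto)+
    show "tight (with_singletons V {M, insert (v i) N, B})"
      by (rule tight_with_singletons[OF after, of "i - r" "i + 1" "insert (v i) N" "i + p + 1" M B])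
        (fact in_xN in_M in_B | use pr sizes disjoint k_eq in \<open>auto simp: add.commute[of 1]\<close>)+
  qed (use disjoint in auto)
  then show ?thesis
    unfolding M_def N_def using pr k_eq sum_weights_arc_after sum_weights_arc_before by simp
qed

lemma weight_zero_terminals:
  assumes "2 \<le> n" "n \<le> d - 1"
  shows "\<alpha> {v i, v (i + n)} = 0"
proof -
  have "(\<Sum>l\<in>{i + 1..i + n}. \<alpha> {v i, v l}) = (\<Sum>l\<in>{i - (d + 1 - n)..i - 1}. \<alpha> {v i, v l})"
    using assms by (intro sum_weights_terminal_balance) (auto simp: tight_sizes_def)
  also have "\<dots> = (\<Sum>l\<in>{i + 1..i + (n - 1)}. \<alpha> {v i, v l})"
    using assms by (intro sum_weights_terminal_balance[symmetric]) (auto simp: tight_sizes_def)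
  also have "{i + 1..i + n} = insert (i + n) {i + 1..i + (n - 1)}" using assms by auto
  finally show ?thesis by simp
qed

lemma weight_step_shift: "\<alpha> {v i, v (i + 1)} = \<alpha> {v (i - 1), v i}"
proof -
  have "(\<Sum>l\<in>{i + 1..i + 1}. \<alpha> {v i, v l}) = (\<Sum>l\<in>{i - (d - 1)..i - 1}. \<alpha> {v i, v l})"
    using d_ge by (intro sum_weights_terminal_balance) (auto simp: tight_sizes_def)
  also have "\<dots> = (\<Sum>l\<in>{i - 1}. \<alpha> {v i, v l})"
  proof (rule sum.mono_neutral_right)
    show "\<forall>l\<in>{i - (d - 1)..i - 1} - {i - 1}. \<alpha> {v i, v l} = 0"
    proof
      fix l assume "l \<in> {i - (d - 1)..i - 1} - {i - 1}"
      then show "\<alpha> {v i, v l} = 0"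
        using weight_zero_terminals[of "i - l" l] by (simp add: insert_commute)
    qed
  qed (use d_ge in auto)
  finally show ?thesis by (simp add: insert_commute)
qed

lemma weight_step_plus_chord: "\<alpha> {v i, v (i + 1)} + \<alpha> {v i, v (i + d)} = 0"
proof -
  have "(\<Sum>l\<in>{i + 1, i + d}. \<alpha> {v i, v l}) = (\<Sum>l\<in>{i + 1..i + d}. \<alpha> {v i, v l})"
  proof (rule sum.mono_neutral_left)
    show "\<forall>l\<in>{i + 1..i + d} - {i + 1, i + d}. \<alpha> {v i, v l} = 0"
    proof
      fix l assume "l \<in> {i + 1..i + d} - {i + 1, i + d}"
      then show "\<alpha> {v i, v l} = 0" using weight_zero_terminals[of "l - i" i] by auto
    qed
  qed (use d_ge in auto)
  also have "\<dots> = (\<Sum>l\<in>{i - 0..i - 1}. \<alpha> {v i, v l})"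
    using d_ge by (intro sum_weights_terminal_balance) (auto simp: tight_sizes_def)
  finally show ?thesis using d_ge by simp
qed

lemma weight_step_eq: "\<alpha> {v i, v (i + 1)} = \<alpha> {v 0, v 1}"
proof (induction i rule: int_induct[where k = 0])
  case (step1 i)
  then show ?case using weight_step_shift[of "i + 1"] by simp
next
  case (step2 i)
  then show ?case using weight_step_shift[of i] by simp
qed simp

lemma weight_chord_eq: "\<alpha> {v i, v (i + d)} = - \<alpha> {v 0, v 1}"
  using weight_step_plus_chord[of i] weight_step_eq[of i] by simp

lemma terminal_pair_cases:
  obtains i n where "{v a, v b} = {v i, v (i + n)}" "0 \<le> n" "n \<le> d"
proof -
  define n where "n = (b - a) mod k"
  have "v b = v (a + n)"
    unfolding n_def using v_mod[of b] v_mod[of "a + (b - a) mod k"] by (simp add: mod_add_right_eq)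
  have "0 < k" using k_eq d_ge by simp
  then have "0 \<le> n" "n < k" unfolding n_def by simp_all
  show ?thesis
  proof (cases "n \<le> d")
    case True
    then show ?thesis using that[of a n] \<open>v b = v (a + n)\<close> \<open>0 \<le> n\<close> by simp
  next
    case False
    have "v (a + n + (k - n)) = v a" using v_period[of a] by simp
    then show ?thesis
      using that[of "a + n" "k - n"] False \<open>v b = v (a + n)\<close> \<open>n < k\<close> k_eq by (simp add: insert_commute)
  qed
qed

lemma weights_vanish:
  assumes sum0: "(\<Sum>i\<in>{0..<k}. \<alpha> {v i, v (i + d)} - \<alpha> {v i, v (i + 1)}) = 0" and e: "e \<in> pairs V"
  shows "\<alpha> e = 0"
proof -
  have step: "\<alpha> {v i, v (i + 1)} = 0" for i
    using sum0 k_eq d_ge unfolding weight_step_eq weight_chord_eq by simp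
  then have chord: "\<alpha> {v i, v (i + d)} = 0" for i
    using weight_step_plus_chord[of i] by simp
  from e obtain a b where ab: "e = {a, b}" "a \<in> V" "b \<in> V" "a \<noteq> b" by (rule pairs_cases)
  show ?thesis
  proof (cases "a \<in> range v \<and> b \<in> range v")
    case True
    then obtain i n where n: "e = {v i, v (i + n)}" "0 \<le> n" "n \<le> d"
      using terminal_pair_cases ab(1) by (metis rangeE)
    then have "n \<noteq> 0" using ab by auto
    then consider "n = 1" | "n = d" | "2 \<le> n" "n \<le> d - 1" using n by linarith
    then show ?thesis using step chord weight_zero_terminals n(1) by cases auto
  next
    case False
    then show ?thesis using weight_zero_nonterminal[of a b] weight_zero_nonterminal[of b a] ab
      by (auto simp: insert_commute)
  qed
qed

end

subsection \<open>Unrolling a sequence that is true to the cycle\<close>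

lemma strict_mono_int_step:
  fixes q :: "int \<Rightarrow> int"
  assumes "\<And>i. q i < q (i + 1)"
  shows "strict_mono q"
proof (rule strict_monoI)
  fix i j :: int
  assume "i < j"
  then show "q i < q j"
    by (induction j rule: int_gr_induct) (use assms order.strict_trans in blast)+
qed

definition periodic_extension :: "nat \<Rightarrow> int \<Rightarrow> (nat \<Rightarrow> int) \<Rightarrow> int \<Rightarrow> int" where
  "periodic_extension k m f i = f (nat (i mod int k)) + m * (i div int k)"

lemma periodic_extension_period:
  "0 < k \<Longrightarrow> periodic_extension k m f (i + int k) = periodic_extension k m f i + m"
  by (simp add: periodic_extension_def algebra_simps)

lemma strict_mono_periodic_extension:
  assumes "0 < k" and step: "\<And>i. i + 1 < k \<Longrightarrow> f i < f (i + 1)" and wrap: "f (k - 1) < f 0 + m"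
  shows "strict_mono (periodic_extension k m f)"
proof (rule strict_mono_int_step)
  fix i
  define n where "n = nat (i mod int k)"
  have n: "n < k" "i mod int k = int n" using \<open>0 < k\<close> by (simp_all add: n_def nat_less_iff)
  show "periodic_extension k m f i < periodic_extension k m f (i + 1)"
  proof (cases "n + 1 < k")
    case True
    have "i + 1 = int k * (i div int k) + int (n + 1)" using mult_div_mod_eq[of "int k" i] n(2) by simp
    from int_mod_pos_eq[OF this] int_div_pos_eq[OF this]
    have "(i + 1) mod int k = int (n + 1)" "(i + 1) div int k = i div int k" using True by simp_all
    then show ?thesis using step[OF True] n(2) by (simp add: periodic_extension_def nat_add_distrib)
  next
    case False
    then have "n = k - 1" using n(1) by simp
    have "i + 1 = int k * (i div int k + 1) + 0"
      using mult_div_mod_eq[of "int k" i] n False by (simp add: algebra_simps)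
    from int_mod_pos_eq[OF this] int_div_pos_eq[OF this]
    have "(i + 1) mod int k = 0" "(i + 1) div int k = i div int k + 1" using \<open>0 < k\<close> by simp_all
    then show ?thesis using wrap n(2) \<open>n = k - 1\<close> by (simp add: periodic_extension_def algebra_simps)
  qed
qed

lemma cyc_cc_offset_le:
  assumes "a < m" "x \<in> cyc_cc m a b"
  shows "(int x - int a) mod int m \<le> (int b - int a) mod int m"
proof -
  from assms obtain j where j: "x = (a + j) mod m" "j \<le> (b + m - a) mod m" by (auto simp: cyc_cc_def)
  have "int ((b + m - a) mod m) = (int b - int a + int m) mod int m"
    using assms(1) by (simp add: of_nat_mod of_nat_diff algebra_simps)
  then have offset: "int j \<le> (int b - int a) mod int m" using j(2) by simp
  moreover have "(int b - int a) mod int m < int m" using assms(1) by simp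
  ultimately have "(int x - int a) mod int m = int j"
    using j(1) by (simp add: of_nat_mod mod_diff_left_eq)
  then show ?thesis using offset by simp
qed

lemma mod_offset_inj:
  assumes "x < m" "y < m" "(int x - c) mod int m = (int y - c) mod int m"
  shows "x = y"
proof -
  have "(int x - c + c) mod int m = (int y - c + c) mod int m"
    using assms(3) by (rule mod_add_cong) simp
  then show ?thesis using assms(1,2) by simp
qed

lemma cyc_co_offset_less:
  assumes "a < m" "b < m" "x < m" "x \<in> cyc_co m a b"
  shows "(int x - int a) mod int m < (int b - int a) mod int m"
proof -
  have "x \<in> cyc_cc m a b" "x \<noteq> b" using assms(4) by (auto simp: cyc_co_def)
  then have "(int x - int a) mod int m \<le> (int b - int a) mod int m"
    and "(int x - int a) mod int m \<noteq> (int b - int a) mod int m"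
    using cyc_cc_offset_le[OF assms(1)] mod_offset_inj[OF assms(3,2)] by blast+
  then show ?thesis by simp
qed

lemma cyc_oc_offset_less:
  assumes "a < m" "b < m" "x < m" "x \<in> cyc_oc m b a"
  shows "(int a - int x) mod int m < (int a - int b) mod int m"
proof -
  let ?x = "(int x - int b) mod int m" and ?a = "(int a - int b) mod int m"
  have x: "?x \<le> ?a" "x \<noteq> b" using assms(4) cyc_cc_offset_le[OF assms(2)] by (auto simp: cyc_oc_def)
  have "?x \<noteq> 0" using x(2) mod_offset_inj[of x m b "int b"] assms by auto
  moreover have bounds: "0 \<le> ?x" "?a < int m" using assms(1) by simp_all
  ultimately have "0 < ?x" by simp
  have "(int a - int x) mod int m = (?a - ?x) mod int m"
    by (simp add: mod_diff_left_eq mod_diff_right_eq)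
  also have "\<dots> = ?a - ?x" using x(1) bounds by (intro mod_pos_pos_trivial) linarith+
  also have "\<dots> < ?a" using \<open>0 < ?x\<close> by simp
  finally show ?thesis .
qed

lemma true_to_cycle_direction:
  fixes m :: nat and p :: "nat \<Rightarrow> nat"
  assumes "true_to_cycle c V\<^sub>C k v" and m: "m = card V\<^sub>C"
    and p: "\<And>i. p i = the_inv_into {..<m} c (v i)" "\<And>i. i < k \<Longrightarrow> p i < m"
  obtains \<sigma> :: int where "\<sigma> \<in> {1, - 1}"
    and "\<And>i. i + 1 < k \<Longrightarrow>
      (\<sigma> * int (p i) - \<sigma> * int (p 0)) mod int m < (\<sigma> * int (p (i + 1)) - \<sigma> * int (p 0)) mod int m"
proof -
  have "(\<forall>i<k - 1. p i \<in> cyc_co m (p 0) (p (i + 1))) \<or> (\<forall>i<k - 1. p i \<in> cyc_oc m (p (i + 1)) (p 0))"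
    using assms(1) unfolding true_to_cycle_def Let_def m[symmetric] p(1)[symmetric] .
  then show ?thesis
  proof
    assume forward: "\<forall>i<k - 1. p i \<in> cyc_co m (p 0) (p (i + 1))"
    show ?thesis
      by (rule that[of 1]) (use forward p(2) in \<open>auto intro!: cyc_co_offset_less\<close>)
  next
    assume backward: "\<forall>i<k - 1. p i \<in> cyc_oc m (p (i + 1)) (p 0)"
    show ?thesis
      by (rule that[of "- 1"]) (use backward p(2) in \<open>auto intro!: cyc_oc_offset_less\<close>)
  qed
qed

lemma unrolled_cycle_labelling:
  assumes "connected_graph V E" "V\<^sub>C \<subseteq> V" "E\<^sub>C \<subseteq> E" and cycle: "cycle_labelling c V\<^sub>C E\<^sub>C"
  shows "unrolled_cycle V E (\<lambda>u. c (nat (u mod int (card V\<^sub>C)))) (int (card V\<^sub>C))"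
proof
  define m where "m = card V\<^sub>C"
  have "0 < m" and bij: "bij_betw c {..<m} V\<^sub>C" and E\<^sub>C: "E\<^sub>C = {{c u, c ((u + 1) mod m)} | u. u < m}"
    using cycle by (auto simp: cycle_labelling_def m_def)
  have pos: "nat (u mod int m) < m" for u using \<open>0 < m\<close> by (simp add: nat_less_iff)
  show "0 < int (card V\<^sub>C)" using \<open>0 < m\<close> by (simp add: m_def)
  fix a b u
  have "c (nat (a mod int m)) = c (nat (b mod int m)) \<longleftrightarrow> nat (a mod int m) = nat (b mod int m)"
    using bij pos by (intro inj_on_eq_iff[of c "{..<m}"]) (auto simp: bij_betw_def)
  also have "\<dots> \<longleftrightarrow> int m dvd a - b" using \<open>0 < m\<close> by (simp add: nat_eq_iff mod_eq_dvd_iff)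
  finally show "c (nat (a mod int (card V\<^sub>C))) = c (nat (b mod int (card V\<^sub>C))) \<longleftrightarrow> int (card V\<^sub>C) dvd a - b"
    unfolding m_def .
  have "c (nat (u mod int m)) \<in> V\<^sub>C" using bij pos by (auto simp: bij_betw_def)
  then show "c (nat (u mod int (card V\<^sub>C))) \<in> V" using assms(2) by (auto simp: m_def)
  have "(u + 1) mod int m = int ((nat (u mod int m) + 1) mod m)"
    using \<open>0 < m\<close> by (simp add: of_nat_mod mod_simps add.commute)
  then have "nat ((u + 1) mod int m) = (nat (u mod int m) + 1) mod m" by simp
  then have "{c (nat (u mod int m)), c (nat ((u + 1) mod int m))} \<in> E\<^sub>C" using pos[of u] unfolding E\<^sub>C by auto
  then show "{c (nat (u mod int (card V\<^sub>C))), c (nat ((u + 1) mod int (card V\<^sub>C)))} \<in> E"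
    using assms(3) by (auto simp: m_def)
qed (rule assms(1))

lemma (in unrolled_cycle) cyclic_terminals_of_positions:
  fixes p :: "nat \<Rightarrow> int" and k d :: nat
  assumes k: "k = 2 * d + 1" "2 \<le> d"
    and increasing: "\<And>i. i + 1 < k \<Longrightarrow> (p i - p 0) mod m < (p (i + 1) - p 0) mod m"
  obtains q where "cyclic_terminals V E w m q (int k) (int d)" "\<And>i. w (q i) = w (p (nat (i mod int k)))"
proof -
  define f where "f i = p 0 + (p i - p 0) mod m" for i
  define q where "q = periodic_extension k m f"
  have "0 < k" using k by simp
  have "cyclic_terminals V E w m q (int k) (int d)"
  proof
    show "strict_mono q" unfolding q_def
      using \<open>0 < k\<close> m_pos increasing by (intro strict_mono_periodic_extension) (auto simp: f_def)
    show "q (i + int k) = q i + m" for i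
      using \<open>0 < k\<close> by (simp add: q_def periodic_extension_period)
  qed (use k in auto)
  moreover have "w (q i) = w (p (nat (i mod int k)))" for i
  proof -
    let ?n = "nat (i mod int k)"
    have "f ?n - p ?n = - (p ?n - p 0 - (p ?n - p 0) mod m)" by (simp add: f_def)
    then have "m dvd f ?n - p ?n" by (simp only: dvd_minus_iff dvd_minus_mod)
    then have "w (f ?n) = w (p ?n)" by (simp add: w_eq_iff)
    moreover have "w (q i) = w (f ?n)" by (simp add: w_eq_iff q_def periodic_extension_def)
    ultimately show ?thesis by simp
  qed
  ultimately show ?thesis by (rule that)
qed

lemma cyclic_terminals_exist:
  fixes c v :: "nat \<Rightarrow> 'v"
  assumes graph: "connected_graph V E" "V\<^sub>C \<subseteq> V" "E\<^sub>C \<subseteq> E" and cycle: "cycle_labelling c V\<^sub>C E\<^sub>C"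
    and k: "5 \<le> k" "odd k" "d = (k - 1) div 2"
    and v: "v ` {..<k} \<subseteq> V\<^sub>C" "true_to_cycle c V\<^sub>C k v"
  obtains w q where "cyclic_terminals V E w (int (card V\<^sub>C)) q (int k) (int d)"
    and "\<And>i. w (q i) = v (nat (i mod int k))"
proof -
  define m where "m = card V\<^sub>C"
  define p where "p i = the_inv_into {..<m} c (v i)" for i
  define w where "w u = c (nat (u mod int m))" for u
  interpret C: unrolled_cycle V E w "int m"
    unfolding w_def m_def using graph cycle by (rule unrolled_cycle_labelling)
  have bij: "bij_betw c {..<m} V\<^sub>C" using cycle by (simp add: cycle_labelling_def m_def)
  have p_less: "p i < m" and w_p: "w (int (p i)) = v i" if "i < k" for i
  proof -
    have "v i \<in> c ` {..<m}" using v(1) that bij by (auto simp: bij_betw_def)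
    then have "p i \<in> {..<m}" "c (p i) = v i"
      using bij unfolding p_def by (auto simp: bij_betw_def the_inv_into_f_f)
    then show "p i < m" "w (int (p i)) = v i" by (simp_all add: w_def)
  qed
  obtain \<sigma> :: int where \<sigma>: "\<sigma> \<in> {1, - 1}" and increasing: "\<And>i. i + 1 < k \<Longrightarrow>
      (\<sigma> * int (p i) - \<sigma> * int (p 0)) mod int m < (\<sigma> * int (p (i + 1)) - \<sigma> * int (p 0)) mod int m"
    using true_to_cycle_direction[OF v(2) m_def p_def p_less] by blast
  interpret D: unrolled_cycle V E "\<lambda>u. w (\<sigma> * u)" "int m"
    using \<sigma> C.unrolled_cycle_axioms C.unrolled_cycle_reflected by auto
  have "k = 2 * d + 1" "2 \<le> d" using k by (auto elim!: oddE)
  then obtain q where terminals: "cyclic_terminals V E (\<lambda>u. w (\<sigma> * u)) (int m) q (int k) (int d)"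
    and wq: "\<And>i. w (\<sigma> * q i) = w (\<sigma> * (\<sigma> * int (p (nat (i mod int k)))))"
    using D.cyclic_terminals_of_positions[of k d "\<lambda>i. \<sigma> * int (p i)"] increasing by blast
  have "w (\<sigma> * q i) = v (nat (i mod int k))" for i
  proof -
    have "w (\<sigma> * q i) = w (int (p (nat (i mod int k))))" unfolding wq using \<sigma> by auto
    also have "\<dots> = v (nat (i mod int k))" using k(1) by (intro w_p) (simp add: nat_less_iff)
    finally show ?thesis .
  qed
  with terminals show ?thesis unfolding m_def by (rule that)
qed

subsection \<open>The facet\<close>

lemma subspace_subset_span_if_orthogonal_vanish:
  fixes L S :: "'a::euclidean_space set"
  assumes "subspace L" "S \<subseteq> L" and vanish: "\<And>a. a \<in> L \<Longrightarrow> (\<And>y. y \<in> S \<Longrightarrow> orthogonal a y) \<Longrightarrow> a = 0"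
  shows "L \<subseteq> span S"
proof (rule ccontr)
  assume "\<not> L \<subseteq> span S"
  moreover have "span S \<subseteq> L" using assms(1,2) by (intro span_minimal)
  moreover have "span L = L" using assms(1) by simp
  ultimately have "span S \<subset> span L" by blast
  then obtain a where "a \<noteq> 0" "a \<in> span L" "\<And>y. y \<in> span S \<Longrightarrow> orthogonal a y"
    using orthogonal_to_subspace_exists_gen by metis
  then show False using vanish[of a] \<open>span L = L\<close> by (simp add: span_base)
qed

lemma facet_of_if_functionals_vanish:
  fixes P L :: "'a::euclidean_space set"
  assumes "convex P" and L: "subspace L" "P \<subseteq> L" "n \<in> L"
    and le: "\<And>x. x \<in> P \<Longrightarrow> n \<bullet> x \<le> b" and z: "z \<in> P" "n \<bullet> z \<noteq> b" and x: "x \<in> P" "n \<bullet> x = b"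
    and vanish: "\<And>a \<kappa>. a \<in> L \<Longrightarrow> a \<bullet> n = 0 \<Longrightarrow> (\<And>y. y \<in> P \<Longrightarrow> n \<bullet> y = b \<Longrightarrow> a \<bullet> y = \<kappa>) \<Longrightarrow> a = 0"
  shows "{y \<in> P. n \<bullet> y = b} facet_of P"
proof -
  define F where "F = {y \<in> P. n \<bullet> y = b}"
  define S where "S = (+) (- x) ` F"
  have "x \<in> F" using x by (simp add: F_def)
  have "P \<inter> {y. n \<bullet> y = b} face_of P"
    using le by (intro face_of_Int_supporting_hyperplane_le \<open>convex P\<close>) simp
  moreover have "P \<inter> {y. n \<bullet> y = b} = F" by (auto simp: F_def)
  ultimately have face: "F face_of P" by simp
  have "F \<noteq> P" using z by (auto simp: F_def)
  then have less: "aff_dim F < aff_dim P" using face \<open>convex P\<close> by (intro face_of_aff_dim_lt)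
  have "L \<subseteq> span (insert n S)"
  proof (rule subspace_subset_span_if_orthogonal_vanish[OF L(1)])
    have "F \<subseteq> L" using L(2) by (auto simp: F_def)
    then show "insert n S \<subseteq> L" using subspace_diff[OF L(1)] \<open>x \<in> F\<close> L(3) by (auto simp: S_def)
    fix a assume a: "a \<in> L" "\<And>y. y \<in> insert n S \<Longrightarrow> orthogonal a y"
    have "a \<bullet> y = a \<bullet> x" if "y \<in> P" "n \<bullet> y = b" for y
      using a(2)[of "- x + y"] that by (simp add: S_def F_def orthogonal_def inner_diff_right)
    then show "a = 0" using a by (intro vanish[of _ "a \<bullet> x"]) (auto simp: orthogonal_def)
  qed
  then have "dim L \<le> dim (insert n S)" using dim_subset[of L] by (metis dim_span)
  also have "\<dots> \<le> dim S + 1" by (simp add: dim_insert)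
  finally have "int (dim L) \<le> int (dim S) + 1" by simp
  also have "int (dim S) = aff_dim F"
    unfolding S_def using \<open>x \<in> F\<close> by (intro aff_dim_eq_dim[symmetric] hull_inc)
  finally have "int (dim L) \<le> aff_dim F + 1" .
  then have "aff_dim P \<le> aff_dim F + 1"
    using aff_dim_subset[OF L(2)] aff_dim_subspace[OF L(1)] by simp
  then show ?thesis using face \<open>x \<in> F\<close> less unfolding facet_of_def F_def[symmetric] by auto
qed

lemma inner_char_vec: "a \<bullet> char_vec M = sum (($) a) M"
  by (simp add: inner_vec_def char_vec_def if_distrib sum.If_cases cong: if_cong)

lemma char_vec_in_LMC: "decomposition V E P \<Longrightarrow> char_vec (lifted_multicut P) \<in> LMC V E"
  unfolding LMC_def by (intro hull_inc) auto

lemma zero_in_LMC: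
  fixes V :: "'v::finite set"
  assumes "connected_graph V E"
  shows "0 \<in> LMC V E"
proof -
  have "induced_edges E V = E"
    using assms by (auto simp: connected_graph_def simple_graph_def induced_edges_def pairs_def)
  then have "decomposition V E {V}"
    using assms partition_on_space[of V] by (simp add: decomposition_def connected_graph_def)
  moreover have "char_vec (lifted_multicut {V}) = 0"
    by (simp add: vec_eq_iff char_vec_def lifted_multicut_def)
  ultimately show ?thesis using char_vec_in_LMC by metis
qed

definition pair_space :: "'v::finite set \<Rightarrow> (real ^ 'v set) set" where
  "pair_space V = {x. \<forall>e. e \<notin> pairs V \<longrightarrow> x $ e = 0}"

lemma subspace_pair_space: "subspace (pair_space V)"
  by (auto simp: subspace_def pair_space_def)

lemma LMC_subset_pair_space: "LMC V E \<subseteq> pair_space V"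
  unfolding LMC_def
proof (rule hull_minimal)
  show "convex (pair_space V)" using subspace_pair_space by (rule subspace_imp_convex)
  show "{char_vec (lifted_multicut P) |P. decomposition V E P} \<subseteq> pair_space V"
    using lifted_multicut_subset_pairs by (fastforce simp: decomposition_def pair_space_def char_vec_def)
qed

locale half_chorded_cycle = cyclic_terminals V E w m q k d
  for V :: "'v::finite set" and E :: "'v set set" and w :: "int \<Rightarrow> 'v" and m :: int
    and q :: "int \<Rightarrow> int" and k d :: int
begin

definition half_chorded :: "real ^ 'v set \<Rightarrow> real" where
  "half_chorded x = (\<Sum>i\<in>{0..<k}. x $ {v i, v (i + d)} - x $ {v i, v (i + 1)})"

definition normal :: "real ^ 'v set" where
  "normal = (\<Sum>i\<in>{0..<k}. axis {v i, v (i + d)} 1 - axis {v i, v (i + 1)} 1)"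

lemma half_chorded_eq_inner: "half_chorded x = normal \<bullet> x"
  unfolding half_chorded_def normal_def by (simp add: inner_sum_left inner_diff_left inner_axis')

lemma normal_in_pair_space: "normal \<in> pair_space V"
  unfolding normal_def
proof (intro subspace_sum subspace_pair_space subspace_diff)
  fix i
  have "v i \<noteq> v (i + d)" "v i \<noteq> v (i + 1)" using k_eq d_ge by (intro v_distinct; simp)+
  then show "axis {v i, v (i + d)} 1 \<in> pair_space V" "axis {v i, v (i + 1)} 1 \<in> pair_space V"
    using w_in by (auto simp: pair_space_def axis_def doubleton_in_pairs_iff)
qed

lemma half_chorded_char_vec:
  assumes "partition_on V P"
  shows "half_chorded (char_vec (lifted_multicut P)) = of_int (excess k d (\<lambda>i. containing_blocks P (v i)))"
  unfolding half_chorded_def excess_def of_int_sum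
  using doubleton_in_lifted_multicut_iff[OF assms w_in w_in] by (intro sum.cong) (auto simp: char_vec_def)

lemma half_chorded_eq_iff_tight:
  assumes "decomposition V E P"
  shows "half_chorded (char_vec (lifted_multicut P)) = of_int k - 3 \<longleftrightarrow> tight P"
proof -
  have "half_chorded (char_vec (lifted_multicut P)) = of_int (excess k d (\<lambda>i. containing_blocks P (v i)))"
    using assms by (intro half_chorded_char_vec) (simp add: decomposition_def)
  also have "\<dots> = of_int k - 3 \<longleftrightarrow> tight P"
    unfolding tight_def by (metis of_int_diff of_int_eq_iff of_int_numeral)
  finally show ?thesis .
qed

lemma half_chorded_le:
  assumes "x \<in> LMC V E"
  shows "half_chorded x \<le> of_int k - 3"
proof -
  have "normal \<bullet> char_vec (lifted_multicut P) \<le> of_int k - 3" if "decomposition V E P" for P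
  proof -
    interpret odd_cycle_colouring "\<lambda>i. containing_blocks P (v i)" k d
      by (rule odd_cycle_colouring_containing_blocks)
    have "real_of_int (excess k d (\<lambda>i. containing_blocks P (v i))) \<le> of_int (k - 3)"
      unfolding of_int_le_iff by (rule excess_le)
    then show ?thesis
      using that half_chorded_char_vec[of P] by (simp add: decomposition_def half_chorded_eq_inner)
  qed
  then have "LMC V E \<subseteq> {x. normal \<bullet> x \<le> of_int k - 3}"
    unfolding LMC_def by (intro hull_minimal convex_halfspace_le) auto
  then show ?thesis using assms by (auto simp: half_chorded_eq_inner)
qed

theorem half_chorded_facet: "facet_defining (LMC V E) half_chorded (of_int k - 3)"
proof -
  obtain P where P: "decomposition V E P" "tight P" using tight_decomposition_exists by blast
  have "{x \<in> LMC V E. normal \<bullet> x = of_int k - 3} facet_of LMC V E"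
  proof (rule facet_of_if_functionals_vanish)
    show "convex (LMC V E)" by (simp add: LMC_def)
    show "normal \<bullet> x \<le> of_int k - 3" if "x \<in> LMC V E" for x
      using half_chorded_le[OF that] by (simp add: half_chorded_eq_inner)
    show "normal \<bullet> 0 \<noteq> of_int k - 3" using k_eq d_ge by simp
    show "char_vec (lifted_multicut P) \<in> LMC V E" "normal \<bullet> char_vec (lifted_multicut P) = of_int k - 3"
      using P half_chorded_eq_iff_tight by (simp_all add: char_vec_in_LMC half_chorded_eq_inner)
    fix a \<kappa>
    assume a: "a \<in> pair_space V" "a \<bullet> normal = 0"
      and const: "\<And>x. x \<in> LMC V E \<Longrightarrow> normal \<bullet> x = of_int k - 3 \<Longrightarrow> a \<bullet> x = \<kappa>"
    interpret tight_weights V E w m q k d "($) a" \<kappa>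
    proof
      fix P assume "decomposition V E P" "tight P"
      then show "sum (($) a) (lifted_multicut P) = \<kappa>"
        using const[OF char_vec_in_LMC] half_chorded_eq_iff_tight by (simp add: inner_char_vec half_chorded_eq_inner)
    qed
    have "(\<Sum>i\<in>{0..<k}. a $ {v i, v (i + d)} - a $ {v i, v (i + 1)}) = 0"
      using a(2) half_chorded_eq_inner[of a] by (simp add: half_chorded_def inner_commute)
    then have "a $ e = 0" if "e \<in> pairs V" for e using that by (rule weights_vanish)
    then show "a = 0" using a(1) by (auto simp: pair_space_def vec_eq_iff)
  qed (rule subspace_pair_space LMC_subset_pair_space normal_in_pair_space zero_in_LMC[OF conn])+
  moreover have "linear half_chorded"
    unfolding half_chorded_eq_inner[abs_def] by (rule bounded_linear.linear) (rule bounded_linear_inner_right)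
  ultimately show ?thesis using half_chorded_le by (simp add: facet_defining_def half_chorded_eq_inner)
qed

lemma half_chorded_eq_sum_lessThan:
  fixes u :: "nat \<Rightarrow> 'v" and K D :: nat
  assumes "k = int K" "d = int D" and u: "\<And>i. v i = u (nat (i mod k))"
  shows "half_chorded x = (\<Sum>i<K. x $ {u i, u ((i + D) mod K)} - x $ {u i, u ((i + 1) mod K)})"
proof -
  have "v (int n + int r) = u ((n + r) mod K)" for n r
    using u[of "int (n + r)"] by (simp add: assms(1) nat_mod_distrib nat_add_distrib)
  from this[of _ 0] this[of _ D] this[of _ 1]
  have v_int: "n < K \<Longrightarrow> v (int n) = u n" "v (int n + d) = u ((n + D) mod K)" "v (int n + 1) = u ((n + 1) mod K)"
    for n
    using assms(2) by simp_all
  have "{0..<k} = int ` {..<K}" using image_int_atLeastLessThan[of 0 K] by (simp add: assms(1) lessThan_atLeast0)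
  then show ?thesis
    unfolding half_chorded_def by (simp add: sum.reindex v_int)
qed

end

theorem theorem7p27:
  fixes V V\<^sub>C :: "'v::finite set"
    and E E\<^sub>C :: "'v set set"
    and c v :: "nat \<Rightarrow> 'v"
    and k d :: nat
  assumes "connected_graph V E"
    and "V\<^sub>C \<subseteq> V" and "E\<^sub>C \<subseteq> E"
    and "cycle_labelling c V\<^sub>C E\<^sub>C"
    and "5 \<le> k" and "k \<le> card V\<^sub>C" and "odd k"
    and "d = (k - 1) div 2"
    and "v ` {..<k} \<subseteq> V\<^sub>C" and "inj_on v {..<k}"
    and "true_to_cycle c V\<^sub>C k v"
  shows "facet_defining (LMC V E)
    (\<lambda>x. \<Sum>i<k. (x $ {v i, v ((i + d) mod k)} - x $ {v i, v ((i + 1) mod k)}))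
    (real k - 3)"
proof -
  obtain w q where "cyclic_terminals V E w (int (card V\<^sub>C)) q (int k) (int d)"
    and wq: "\<And>i. w (q i) = v (nat (i mod int k))"
    using cyclic_terminals_exist[OF assms(1-5,7-9,11)] by blast
  then interpret half_chorded_cycle V E w "int (card V\<^sub>C)" q "int k" "int d"
    by (intro half_chorded_cycle.intro)
  have "half_chorded = (\<lambda>x. \<Sum>i<k. (x $ {v i, v ((i + d) mod k)} - x $ {v i, v ((i + 1) mod k)}))"
    using half_chorded_eq_sum_lessThan[OF refl refl wq] by blast
  then show ?thesis using half_chorded_facet by simp
qed

end
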